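(* Let $X_1,X_2,\dots$ be i.i.d. with ${\sf E}X_1=0$ and $0<\sigma^2={\sf E}X_1^2<\infty$, let $\lambda>0$ and let $N_\lambda$ be a Poisson random variable with parameter $\lambda$ independent of $X_1,X_2,\dots$. Then $$\Delta_\lambda\equiv\sup_x\big|{\sf P}\big(S_{N_\lambda}<x\sigma\sqrt{\lambda}\big)-\Phi(x)\big|\le\frac{1.8546}{\sigma^2}{\sf E}X_1^2\min\Big\{1,\frac{|X_1|}{\sigma\sqrt{\lambda}}\Big\}.$$
   Context: $S_N=X_1+\dots+X_N$, $S_N=0$ if $N=0$. $\Phi$ is the standard normal distribution function. *)

theory Defs
  imports "HOL-Probability.Probability"
begin

definition std_normal_cdf :: "real \<Rightarrow> real" where
  "std_normal_cdf x = (LBINT t:{..x}. std_normal_density t)"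

end

(* Let Y = X / (sigma sqrt l), let mu be the law of Y and m the law of W = Y_1 + ... + Y_N.
   Exchangeability of the summands and the Poisson weights give, for bounded f,
     E W f(W) = l * INT y (E f(W + y) - E f(W)) mu(dy),
   so W has a zero bias perturbation that is independent of W.  Write L = l * E Y^2 min(1, |Y|).

   Concentration: inserting a test function f with slope 1 on [a, b] and linearly decaying slope
   on margins of width L bounds P(a <= W <= b) by a multiple of b - a + L.

   For the Stein solution f of the half-line indicator, P(W < x) - Phi(x) is, up to sign, l times
   the integral of y * E R(W, y), where R is the first order Taylor remainder of f.  It splits into
   the remainder of a convex function (w f(w) is increasing with total variation at most 1 and locally
   Lipschitz) and of a concave one (controlled by the concentration inequality).  As these have
   opposite signs, only the larger one counts, and 1.8546 L is an upper bound as long as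
   1.8546 L < 1; otherwise there is nothing to prove. *)

theory Submission
  imports Defs
begin

section \<open>The normal distribution function and Mills' ratio\<close>

text \<open>Because the perturbation is independent of W, concentration is needed only for W itself,
  never for a sum with a summand removed. Only second moments are assumed, so the expected remainder
  is estimated twice: by |y|, used for |y| > 1, and by a multiple of y^2 plus a multiple of |y|,
  used for |y| <= 1. This cuts L into the parts \<open>\<beta>2\<close> and \<open>\<beta>3\<close>.
  Origin of the constant: the convex remainder is at most (|w| + 7/10)/2 * y^2, where 7/10 bounds
  the Stein solutions, and E|W| <= 1 turns this into 17/20 * y^2. The concave remainder has the
  smaller quadratic coefficient 1/(4D), but also a linear term d|y|/(2D) caused by the margin width
  d, where D = 1 - \<open>\<beta>2\<close> - \<open>\<beta>3\<close>/(2d). With d = L and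
  \<open>\<beta>2\<close> = 0 one has D = 1/2, so the linear term contributes exactly L and the
  total is 1.85 L. What is left of 1.8546 is slack.\<close>

abbreviation \<Phi> :: "real \<Rightarrow> real" where "\<Phi> \<equiv> std_normal_cdf"
abbreviation \<phi> :: "real \<Rightarrow> real" where "\<phi> \<equiv> std_normal_density"

lemma DERIV_std_normal_density [derivative_intros]:
  assumes "(f has_real_derivative f') (at x within A)"
  shows "((\<lambda>x. \<phi> (f x)) has_real_derivative - f x * f' * \<phi> (f x)) (at x within A)"
  unfolding std_normal_density_def
  by (auto intro!: derivative_eq_intros assms simp: field_simps power2_eq_square)

lemma std_normal_density_pos [simp]: "0 < \<phi> w" "\<phi> w \<noteq> 0"
  using normal_density_pos[of 1 0 w] by simp_all

lemma std_normal_density_tendsto_0: "(\<phi> \<longlongrightarrow> 0) at_top"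
  unfolding std_normal_density_def by real_asymp

lemma std_normal_cdf_eq_cdf: "\<Phi> = cdf std_normal_distribution"
proof
  fix x
  have "\<Phi> x = (\<integral>t. indicator {..x} t \<partial>std_normal_distribution)"
    unfolding std_normal_cdf_def set_lebesgue_integral_def
    by (subst integral_density) (auto intro!: Bochner_Integration.integral_cong)
  then show "\<Phi> x = cdf std_normal_distribution x" by (simp add: cdf_def)
qed

interpretation std_normal: real_distribution std_normal_distribution
  by (rule real_dist_normal_dist)

lemma std_normal_cdf_diff:
  assumes "a \<le> b" shows "\<Phi> b - \<Phi> a = integral {a..b} \<phi>"
proof -
  have i: "set_integrable lborel S \<phi>" if "S \<in> sets borel" for S
    unfolding set_integrable_def using that
    by (intro integrable_mult_indicator) auto
  have "\<Phi> b = \<Phi> a + (LBINT t:{a<..b}. \<phi> t)"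
    unfolding std_normal_cdf_def using assms
    by (subst set_integral_Un[symmetric]) (auto intro!: i simp: ivl_disj_un)
  also have "(LBINT t:{a<..b}. \<phi> t) = (LBINT t:{a..b}. \<phi> t)"
    unfolding set_lebesgue_integral_def
    by (rule integral_cong_AE) (auto intro!: AE_I[where N="{a}"] simp: indicator_def)
  also have "\<dots> = integral {a..b} \<phi>"
    by (rule set_borel_integral_eq_integral) (auto intro: i)
  finally show ?thesis by simp
qed

lemma DERIV_std_normal_cdf_at: "(\<Phi> has_real_derivative \<phi> x) (at x)"
proof -
  have c: "continuous_on {x - 1..x + 1} \<phi>"
    unfolding std_normal_density_def by (intro continuous_intros) auto
  have "((\<lambda>u. integral {x - 1..u} \<phi>) has_real_derivative \<phi> x) (at x within {x - 1..x + 1})"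
    by (rule integral_has_real_derivative[OF c]) auto
  then have "((\<lambda>u. \<Phi> (x - 1) + integral {x - 1..u} \<phi>) has_real_derivative \<phi> x) (at x)"
    by (auto intro!: derivative_eq_intros simp: at_within_Icc_at)
  then show ?thesis
  proof (rule has_field_derivative_transform_within[where d = 1])
    show "\<Phi> (x - 1) + integral {x - 1..x'} \<phi> = \<Phi> x'" if "dist x' x < 1" for x'
      using std_normal_cdf_diff[of "x - 1" x'] that
      by (simp add: dist_real_def abs_less_iff)
  qed auto
qed

lemma DERIV_std_normal_cdf [derivative_intros]:
  assumes "(f has_real_derivative f') (at x within A)"
  shows "((\<lambda>x. \<Phi> (f x)) has_real_derivative \<phi> (f x) * f') (at x within A)"
  using DERIV_chain2[OF DERIV_std_normal_cdf_at assms] .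

lemma std_normal_cdf_mono: "x \<le> y \<Longrightarrow> \<Phi> x \<le> \<Phi> y"
  unfolding std_normal_cdf_eq_cdf by (rule std_normal.cdf_nondecreasing)

lemma std_normal_cdf_range [simp]: "0 \<le> \<Phi> x" "\<Phi> x \<le> 1"
  unfolding std_normal_cdf_eq_cdf
  by (rule std_normal.cdf_nonneg, rule std_normal.cdf_bounded_prob)

lemma std_normal_cdf_at_top: "(\<Phi> \<longlongrightarrow> 1) at_top"
  unfolding std_normal_cdf_eq_cdf by (rule std_normal.cdf_lim_at_top_prob)

lemma std_normal_cdf_at_bot: "(\<Phi> \<longlongrightarrow> 0) at_bot"
  unfolding std_normal_cdf_eq_cdf by (rule std_normal.cdf_lim_at_bot)

text \<open>The sum of both values has derivative 0, so it equals its limit at infinity. This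
  reflection later yields each upper-tail estimate from a lower-tail one.\<close>

lemma std_normal_cdf_minus: "\<Phi> (- x) = 1 - \<Phi> x"
proof -
  define c where "c = \<Phi> x + \<Phi> (- x)"
  have eq: "\<Phi> y + \<Phi> (- y) = c" for y
    unfolding c_def
    by (rule DERIV_isconst_all[where f = "\<lambda>y. \<Phi> y + \<Phi> (- y)"])
      (auto intro!: derivative_eq_intros simp: std_normal_density_def)
  have "((\<lambda>y. \<Phi> y + \<Phi> (- y)) \<longlongrightarrow> 1 + 0) at_top"
    by (intro tendsto_add std_normal_cdf_at_top
        filterlim_compose[OF std_normal_cdf_at_bot filterlim_uminus_at_bot_at_top])
  then have "c = 1"
    unfolding eq by (simp add: tendsto_const_iff)
  then show ?thesis by (simp add: c_def)
qed

section \<open>Tail estimates: Mills' ratio and a bound for \<Phi> (1 - \<Phi>)\<close>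

lemma antimono_tendsto_0_imp_nonneg:
  fixes v :: "real \<Rightarrow> real"
  assumes d: "\<And>t. t \<ge> x \<Longrightarrow> (v has_real_derivative v' t) (at t)"
    and n: "\<And>t. t \<ge> x \<Longrightarrow> v' t \<le> 0" and lim: "(v \<longlongrightarrow> 0) at_top"
  shows "0 \<le> v x"
proof (rule tendsto_upperbound[OF lim])
  show "\<forall>\<^sub>F t in at_top. v t \<le> v x"
    using eventually_ge_at_top[of x]
  proof eventually_elim
    case (elim t)
    show ?case
      by (rule DERIV_nonpos_imp_nonincreasing[OF elim]) (use d n in blast)
  qed
qed simp

text \<open>The difference \<open>v\<close> of the tail and the claimed minorant has a negative
  derivative and vanishes at infinity. No sign of x is assumed; this is what makes
  \<open>w * stein_sol x w\<close> increasing on the whole line.\<close>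

lemma mills_ratio_lower: "x * \<phi> x \<le> (1 + x\<^sup>2) * (1 - \<Phi> x)"
proof -
  define v where "v = (\<lambda>t. (1 - \<Phi> t) - t / (1 + t\<^sup>2) * \<phi> t)"
  have "0 \<le> v x"
  proof (rule antimono_tendsto_0_imp_nonneg[where v = v and x = x and v' = "\<lambda>t. - 2 / (1 + t\<^sup>2)\<^sup>2 * \<phi> t"])
    fix t :: real
    have nz: "1 + t\<^sup>2 \<noteq> 0" using zero_le_power2[of t] by linarith
    show "(v has_real_derivative - 2 / (1 + t\<^sup>2)\<^sup>2 * \<phi> t) (at t)"
      unfolding v_def using nz
      apply (auto intro!: derivative_eq_intros)
      apply (simp add: divide_simps)
      apply algebra
      done
    show "- 2 / (1 + t\<^sup>2)\<^sup>2 * \<phi> t \<le> 0" by simp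
  next
    have "((\<lambda>t::real. t / (1 + t\<^sup>2)) \<longlongrightarrow> 0) at_top" by real_asymp
    then have "(v \<longlongrightarrow> (1 - 1) - 0 * 0) at_top"
      unfolding v_def
      by (intro tendsto_intros std_normal_cdf_at_top std_normal_density_tendsto_0)
    then show "(v \<longlongrightarrow> 0) at_top" by simp
  qed
  moreover have "1 + x\<^sup>2 > 0" using zero_le_power2[of x] by linarith
  ultimately show ?thesis by (simp add: v_def field_simps)
qed

lemma mills_ratio_upper: "x * (1 - \<Phi> x) \<le> \<phi> x"
proof (cases "x > 0")
  case True
  define v where "v = (\<lambda>t. \<phi> t / t - (1 - \<Phi> t))"
  have "0 \<le> v x"
  proof (rule antimono_tendsto_0_imp_nonneg[where v = v and x = x and v' = "\<lambda>t. - \<phi> t / t\<^sup>2"])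
    fix t assume "x \<le> t"
    then have nz: "t \<noteq> 0" using True by simp
    show "(v has_real_derivative - \<phi> t / t\<^sup>2) (at t)"
      unfolding v_def using nz
      by (auto intro!: derivative_eq_intros simp: field_simps power2_eq_square)
    show "- \<phi> t / t\<^sup>2 \<le> 0" by simp
  next
    have "((\<lambda>t::real. 1 / t) \<longlongrightarrow> 0) at_top" by real_asymp
    then have "((\<lambda>t. \<phi> t * (1 / t) - (1 - \<Phi> t)) \<longlongrightarrow> 0 * 0 - (1 - 1)) at_top"
      by (intro tendsto_intros std_normal_cdf_at_top std_normal_density_tendsto_0)
    then show "(v \<longlongrightarrow> 0) at_top" by (simp add: v_def)
  qed
  then show ?thesis using True by (simp add: v_def field_simps)
next
  case False
  then have "x * (1 - \<Phi> x) \<le> 0" by (simp add: mult_nonpos_nonneg)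
  then show ?thesis using order_trans[of _ 0 "\<phi> x"] by simp
qed

lemma std_normal_density_minus: "\<phi> (- x) = \<phi> x"
  by (simp add: std_normal_density_def)

lemma mills_ratio_lower': "- x * \<phi> x \<le> (1 + x\<^sup>2) * \<Phi> x"
  using mills_ratio_lower[of "- x"] by (simp add: std_normal_cdf_minus std_normal_density_minus)

lemma mills_ratio_upper': "- x * \<Phi> x \<le> \<phi> x"
  using mills_ratio_upper[of "- x"] by (simp add: std_normal_cdf_minus std_normal_density_minus)

lemma std_normal_cdf_0: "\<Phi> 0 = 1 / 2"
  using std_normal_cdf_minus[of 0] by simp

text \<open>\<Phi> is concave on the positive half-line, so its chords from 0 get flatter. It
  ensures that the derivative \<open>k'\<close> in the next lemma changes sign at most once
  there.\<close>

lemma std_normal_cdf_slope_antimono: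
  assumes "0 < s" "s \<le> t"
  shows "(2 * \<Phi> t - 1) / t \<le> (2 * \<Phi> s - 1) / s"
proof (rule DERIV_nonpos_imp_nonincreasing[OF assms(2)])
  fix r assume r: "s \<le> r" "r \<le> t"
  with assms have r0: "r > 0" by simp
  have "r * \<phi> r - (\<Phi> r - 1 / 2) \<le> 0 * \<phi> 0 - (\<Phi> 0 - 1 / 2)"
  proof (rule DERIV_nonpos_imp_nonincreasing[where f = "\<lambda>u. u * \<phi> u - (\<Phi> u - 1 / 2)"])
    fix u :: real assume u: "0 \<le> u" "u \<le> r"
    have "((\<lambda>u. u * \<phi> u - (\<Phi> u - 1 / 2)) has_real_derivative - u\<^sup>2 * \<phi> u) (at u)"
      by (auto intro!: derivative_eq_intros simp: power2_eq_square algebra_simps)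
    moreover have "- u\<^sup>2 * \<phi> u \<le> 0" by simp
    ultimately show "\<exists>y. ((\<lambda>u. u * \<phi> u - (\<Phi> u - 1 / 2)) has_real_derivative y) (at u) \<and> y \<le> 0"
      by blast
  qed (use r0 in simp)
  then have le: "2 * \<phi> r * r - (2 * \<Phi> r - 1) \<le> 0"
    by (simp add: std_normal_cdf_0 mult.commute)
  have "((\<lambda>r. (2 * \<Phi> r - 1) / r) has_real_derivative (2 * \<phi> r * r - (2 * \<Phi> r - 1)) / r\<^sup>2) (at r)"
    using r0 by (auto intro!: derivative_eq_intros simp: power2_eq_square)
  moreover have "(2 * \<phi> r * r - (2 * \<Phi> r - 1)) / r\<^sup>2 \<le> 0"
    using le by (simp add: divide_nonpos_nonneg)
  ultimately show "\<exists>y. ((\<lambda>r. (2 * \<Phi> r - 1) / r) has_real_derivative y) (at r) \<and> y \<le> 0"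
    by blast
qed

text \<open>The difference \<open>k\<close> of the two sides is even, nonnegative at 0 and vanishes
  at infinity; on the positive half-line it can only rise first and fall afterwards. At 0 the ratio
  is sqrt(2 pi)/4, about 0.627, which 7/10 rounds up.\<close>

lemma std_normal_cdf_mult_tail_le: "\<Phi> x * (1 - \<Phi> x) \<le> 7 / 10 * \<phi> x"
proof -
  define k where "k = (\<lambda>t. 7 / 10 * \<phi> t - \<Phi> t * (1 - \<Phi> t))"
  define k' where "k' = (\<lambda>t. \<phi> t * (2 * \<Phi> t - 1 - 7 / 10 * t))"
  have d: "(k has_real_derivative k' t) (at t)" for t
    unfolding k_def k'_def by (auto intro!: derivative_eq_intros simp: algebra_simps)
  \<comment> \<open>Since \<Phi> 0 is 1/2 and \<phi> 0 is 1 / sqrt(2 pi), the bound 14/5 is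
    precisely what \<open>0 \<le> k 0\<close> requires.\<close>
  have "2 * pi \<le> (14 / 5)\<^sup>2" using pi_approx(2) by (simp add: power2_eq_square)
  then have "sqrt (2 * pi) \<le> 14 / 5" by (rule real_le_lsqrt[rotated -1]) auto
  then have k0: "0 \<le> k 0" by (simp add: k_def std_normal_cdf_0 std_normal_density_def field_simps)
  have pos: "0 \<le> k t" if t: "t > 0" for t
  \<comment> \<open>If the chord slope at t is still at least 7/10, \<open>k\<close> increases from
    0 to t; otherwise it decreases from t on, towards its limit 0.\<close>
  proof (cases "(2 * \<Phi> t - 1) / t \<ge> 7 / 10")
    case True
    have "k 0 \<le> k t"
    proof (rule DERIV_nonneg_imp_nondecreasing[where f = k])
      fix s assume s: "0 \<le> s" "s \<le> t"
      have "0 \<le> 2 * \<Phi> s - 1 - 7 / 10 * s"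
      proof (cases "s = 0")
        case False
        then have "7 / 10 \<le> (2 * \<Phi> s - 1) / s"
          using order_trans[OF True std_normal_cdf_slope_antimono[of s t]] s by simp
        then show ?thesis using s False by (simp add: field_simps)
      qed (simp add: std_normal_cdf_0)
      then have "0 \<le> k' s" unfolding k'_def by simp
      then show "\<exists>y. (k has_real_derivative y) (at s) \<and> 0 \<le> y" using d by blast
    qed (use t in simp)
    then show ?thesis using k0 by simp
  next
    case False
    show ?thesis
    proof (rule antimono_tendsto_0_imp_nonneg[OF d])
      fix s assume s: "t \<le> s"
      then have "(2 * \<Phi> s - 1) / s \<le> 7 / 10"
        using order_trans[OF std_normal_cdf_slope_antimono[of t s], of "7 / 10"] t False by simp
      then have "2 * \<Phi> s - 1 - 7 / 10 * s \<le> 0" using s t by (simp add: field_simps)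
      then show "k' s \<le> 0" unfolding k'_def by (simp add: mult_nonneg_nonpos)
    next
      have "(k \<longlongrightarrow> 7 / 10 * 0 - 1 * (1 - 1)) at_top" unfolding k_def
        by (intro tendsto_intros std_normal_cdf_at_top std_normal_density_tendsto_0)
      then show "(k \<longlongrightarrow> 0) at_top" by simp
    qed
  qed
  have "k (- x) = k x" by (simp add: k_def std_normal_cdf_minus std_normal_density_minus)
  then have "0 \<le> k x" using pos[of x] pos[of "- x"] k0 by (cases x "0::real" rule: linorder_cases) auto
  then show ?thesis by (simp add: k_def)
qed

section \<open>The Stein equation for half-lines\<close>

lemma mono_piecewiseI:
  fixes f :: "real \<Rightarrow> real"
  assumes lo: "\<And>u v. u \<le> v \<Longrightarrow> v \<le> x \<Longrightarrow> f u \<le> f v"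
    and hi: "\<And>u v. x \<le> u \<Longrightarrow> u \<le> v \<Longrightarrow> f u \<le> f v"
  shows "mono f"
proof
  fix u v :: real assume "u \<le> v"
  then show "f u \<le> f v"
    using lo[of u v] hi[of u v] lo[of u x] hi[of x v] by linarith
qed

text \<open>Both formulas are assumed to hold at x as well, so the one-sided derivatives agree there
  and glue to a two-sided one.\<close>

lemma has_real_derivative_piecewiseI:
  fixes f lo hi :: "real \<Rightarrow> real"
  assumes lo: "\<And>w. w \<le> x \<Longrightarrow> f w = lo w" "\<And>w. (lo has_real_derivative lo' w) (at w)"
    and hi: "\<And>w. x \<le> w \<Longrightarrow> f w = hi w" "\<And>w. (hi has_real_derivative hi' w) (at w)"
    and f': "\<And>w. w \<le> x \<Longrightarrow> f' w = lo' w" "\<And>w. x \<le> w \<Longrightarrow> f' w = hi' w"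
  shows "(f has_real_derivative f' w) (at w)"
proof -
  consider "w < x" | "x < w" | "w = x" by linarith
  then show ?thesis
  proof cases
    case 1
    then have "(f has_real_derivative lo' w) (at w)"
      by (intro has_field_derivative_transform_within_open[OF lo(2), where S = "{..<x}"])
        (auto simp: lo(1))
    then show ?thesis using 1 f'(1) by simp
  next
    case 2
    then have "(f has_real_derivative hi' w) (at w)"
      by (intro has_field_derivative_transform_within_open[OF hi(2), where S = "{x<..}"])
        (auto simp: hi(1))
    then show ?thesis using 2 f'(2) by simp
  next
    case 3
    have "(f has_real_derivative f' x) (at x within {..x})"
      unfolding f'(1)[OF order_refl]
      by (rule has_field_derivative_transform_within[OF has_field_derivative_at_within[OF lo(2)], where d = 1])
        (auto simp: lo(1))
    moreover have "(f has_real_derivative f' x) (at x within {x..})"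
      unfolding f'(2)[OF order_refl]
      by (rule has_field_derivative_transform_within[OF has_field_derivative_at_within[OF hi(2)], where d = 1])
        (auto simp: hi(1))
    moreover have "{..x} \<union> {x..} = UNIV" by auto
    then have "at x = sup (at x within {..x}) (at x within {x..})"
      using at_within_union[of x "{..x}" "{x..}"] by simp
    ultimately show ?thesis
      unfolding 3 has_field_derivative_iff by (auto intro: filterlim_sup)
  qed
qed

text \<open>The bounded solution of f' w - w * f w = 1 - \<Phi> x for w < x and = - \<Phi> x for w >
  x; it has a kink at x.\<close>

definition stein_sol :: "real \<Rightarrow> real \<Rightarrow> real" where
  "stein_sol x w = (if w \<le> x then \<Phi> w * (1 - \<Phi> x) else (1 - \<Phi> w) * \<Phi> x) / \<phi> w"

lemma stein_sol_nonneg: "0 \<le> stein_sol x w"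
  by (simp add: stein_sol_def)

text \<open>By monotonicity of \<Phi> the numerator grows when x is replaced by w, so the worst
  half-line is the one ending at w.\<close>

lemma stein_sol_le: "stein_sol x w \<le> 7 / 10"
proof -
  have "(if w \<le> x then \<Phi> w * (1 - \<Phi> x) else (1 - \<Phi> w) * \<Phi> x) \<le> \<Phi> w * (1 - \<Phi> w)"
    by (auto simp: mult.commute[of "\<Phi> w"] intro!: mult_mono std_normal_cdf_mono)
  also have "\<dots> \<le> 7 / 10 * \<phi> w"
    by (rule std_normal_cdf_mult_tail_le)
  finally show ?thesis by (simp add: stein_sol_def divide_le_eq)
qed

lemma stein_sol_upper_branch: "x \<le> w \<Longrightarrow> stein_sol x w = (1 - \<Phi> w) * \<Phi> x / \<phi> w"
  by (cases "w = x") (auto simp: stein_sol_def mult.commute)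

text \<open>A form of Mills' ratio. Together with its reflection it confines
  \<open>w * stein_sol x w\<close> to an interval of length 1, which bounds both its variation and
  the slope of \<open>stein_sol\<close>.\<close>

lemma mult_stein_sol_ge: "- (1 - \<Phi> x) \<le> w * stein_sol x w"
proof (cases "w \<le> x")
  case True
  have "- w * \<Phi> w * (1 - \<Phi> x) \<le> \<phi> w * (1 - \<Phi> x)"
    by (intro mult_right_mono mills_ratio_upper') simp
  then show ?thesis using True by (simp add: stein_sol_def field_simps)
next
  case False
  show ?thesis
  proof (cases "w \<ge> 0")
    case True
    then have "0 \<le> w * stein_sol x w" by (simp add: stein_sol_nonneg)
    then show ?thesis using std_normal_cdf_range(2)[of x] by linarith
  next
    case neg: False
    have "- w * \<Phi> x \<le> - w * \<Phi> w"
      using neg False by (intro mult_left_mono std_normal_cdf_mono) auto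
    also have "\<dots> \<le> \<phi> w" by (rule mills_ratio_upper')
    finally have "- w * \<Phi> x * (1 - \<Phi> w) \<le> \<phi> w * (1 - \<Phi> x)"
      using False by (intro mult_mono) (auto intro: std_normal_cdf_mono)
    then show ?thesis using False by (simp add: stein_sol_def field_simps)
  qed
qed

lemma stein_sol_reflect: "stein_sol x w = stein_sol (- x) (- w)"
  using stein_sol_upper_branch[of "- x" "- w"] stein_sol_upper_branch[of x w]
  by (cases "w \<le> x")
    (auto simp: stein_sol_def std_normal_cdf_minus std_normal_density_minus mult.commute)

lemma mult_stein_sol_le: "w * stein_sol x w \<le> \<Phi> x"
  using mult_stein_sol_ge[of "- x" "- w"]
  by (simp add: std_normal_cdf_minus flip: stein_sol_reflect)

lemma DERIV_stein_lower:
  "((\<lambda>w. \<Phi> w * (1 - \<Phi> x) / \<phi> w) has_real_derivative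
     w * (\<Phi> w * (1 - \<Phi> x) / \<phi> w) + (1 - \<Phi> x)) (at w)"
  by (auto intro!: derivative_eq_intros simp: field_simps)

lemma DERIV_stein_upper:
  "((\<lambda>w. (1 - \<Phi> w) * \<Phi> x / \<phi> w) has_real_derivative
     w * ((1 - \<Phi> w) * \<Phi> x / \<phi> w) - \<Phi> x) (at w)"
  by (auto intro!: derivative_eq_intros simp: field_simps)

text \<open>On each branch the derivative is nonnegative by the lower Mills bound; this is the
  convexity of the primitive.\<close>

lemma mono_mult_stein_sol: "mono (\<lambda>w. w * stein_sol x w)"
proof (rule mono_piecewiseI)
  \<comment> \<open>Stated for a free parameter \<open>y\<close>, so that the case
    \<open>- x\<close> also serves the upper branch by reflection.\<close>
  have 1: "u * (\<Phi> u * (1 - \<Phi> y) / \<phi> u) \<le> v * (\<Phi> v * (1 - \<Phi> y) / \<phi> v)" if "u \<le> v" for u v y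
  proof (rule DERIV_nonneg_imp_nondecreasing[OF that])
    fix w
    have "((\<lambda>w. w * (\<Phi> w * (1 - \<Phi> y) / \<phi> w)) has_real_derivative
        (1 - \<Phi> y) * (w + (1 + w\<^sup>2) * \<Phi> w / \<phi> w)) (at w)"
      by (rule derivative_eq_intros DERIV_stein_lower refl)+ (simp add: field_simps power2_eq_square)
    moreover have "0 \<le> w + (1 + w\<^sup>2) * \<Phi> w / \<phi> w"
      using mills_ratio_lower'[of w] by (simp add: field_simps)
    ultimately show "\<exists>D. ((\<lambda>w. w * (\<Phi> w * (1 - \<Phi> y) / \<phi> w)) has_real_derivative D) (at w) \<and> 0 \<le> D"
      by (intro exI conjI) (assumption, simp)
  qed
  show "u * stein_sol x u \<le> v * stein_sol x v" if "u \<le> v" "v \<le> x" for u v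
    using 1[of u v x] that by (simp add: stein_sol_def)
  show "u * stein_sol x u \<le> v * stein_sol x v" if "x \<le> u" "u \<le> v" for u v
    using 1[of "- v" "- u" "- x"] that
    by (simp add: stein_sol_upper_branch std_normal_cdf_minus std_normal_density_minus mult.commute)
qed

text \<open>The primitive of \<open>w * stein_sol x w\<close> is convex, whereas the remaining term \<open>min w x\<close> of
  \<open>stein_sol\<close> is concave: their Taylor remainders have opposite signs and need not be added up.\<close>

definition stein_prim :: "real \<Rightarrow> real \<Rightarrow> real" where
  "stein_prim x w = stein_sol x w - min w x + \<Phi> x * w"

text \<open>The slopes of \<open>stein_sol x\<close> and of \<open>min w x\<close> both drop by 1 at
  x, so the kinks cancel and the difference is differentiable everywhere.\<close>

lemma DERIV_stein_prim: "(stein_prim x has_real_derivative w * stein_sol x w) (at w)"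
proof (rule has_real_derivative_piecewiseI)
  show "((\<lambda>w. \<Phi> w * (1 - \<Phi> x) / \<phi> w - w + \<Phi> x * w) has_real_derivative
      w * (\<Phi> w * (1 - \<Phi> x) / \<phi> w)) (at w)" for w
    by (rule derivative_eq_intros DERIV_stein_lower refl)+ simp
  show "((\<lambda>w. (1 - \<Phi> w) * \<Phi> x / \<phi> w - x + \<Phi> x * w) has_real_derivative
      w * ((1 - \<Phi> w) * \<Phi> x / \<phi> w)) (at w)" for w
    by (rule derivative_eq_intros DERIV_stein_upper refl)+ simp
qed (auto simp: stein_prim_def stein_sol_upper_branch, auto simp: stein_sol_def)

lemma stein_prim_mvt:
  assumes "u \<le> v"
  shows "stein_prim x v - stein_prim x u \<le> \<Phi> x * (v - u)"
    and "- (1 - \<Phi> x) * (v - u) \<le> stein_prim x v - stein_prim x u"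
proof -
  have "stein_prim x v - \<Phi> x * v \<le> stein_prim x u - \<Phi> x * u"
  proof (rule DERIV_nonpos_imp_nonincreasing[OF assms])
    fix w
    have "((\<lambda>w. stein_prim x w - \<Phi> x * w) has_real_derivative w * stein_sol x w - \<Phi> x) (at w)"
      by (rule derivative_eq_intros DERIV_stein_prim refl)+ simp
    then show "\<exists>D. ((\<lambda>w. stein_prim x w - \<Phi> x * w) has_real_derivative D) (at w) \<and> D \<le> 0"
      using mult_stein_sol_le[of w x] by (intro exI conjI) (assumption, simp)
  qed
  then show "stein_prim x v - stein_prim x u \<le> \<Phi> x * (v - u)"
    by (simp add: algebra_simps)
  have "stein_prim x u + (1 - \<Phi> x) * u \<le> stein_prim x v + (1 - \<Phi> x) * v"
  proof (rule DERIV_nonneg_imp_nondecreasing[OF assms])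
    fix w
    have "((\<lambda>w. stein_prim x w + (1 - \<Phi> x) * w) has_real_derivative w * stein_sol x w + (1 - \<Phi> x)) (at w)"
      by (rule derivative_eq_intros DERIV_stein_prim refl)+ simp
    then show "\<exists>D. ((\<lambda>w. stein_prim x w + (1 - \<Phi> x) * w) has_real_derivative D) (at w) \<and> 0 \<le> D"
      using mult_stein_sol_ge[of x w] by (intro exI conjI) (assumption, simp)
  qed
  then show "- (1 - \<Phi> x) * (v - u) \<le> stein_prim x v - stein_prim x u"
    by (simp add: algebra_simps)
qed

text \<open>Adding back \<open>min w x - \<Phi> x * w\<close> shifts slopes in
  [\<Phi> x - 1, \<Phi> x] to [0, 1] left of x and to [-1, 0] right of it. The detour through
  \<open>stein_prim\<close> avoids differentiating at the kink.\<close>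

lemma stein_sol_Lipschitz: "\<bar>stein_sol x v - stein_sol x u\<bar> \<le> \<bar>v - u\<bar>"
proof -
  have *: "\<bar>stein_sol x v - stein_sol x u\<bar> \<le> v - u" if "u \<le> v" for u v
    using stein_prim_mvt[OF that, of x] that unfolding stein_prim_def
    by (auto simp: algebra_simps abs_le_iff min_def split: if_splits)
  show ?thesis using *[of u v] *[of v u] by (cases "u \<le> v") (auto simp: abs_minus_commute)
qed

lemma mult_stein_sol_Lipschitz:
  "\<bar>v * stein_sol x v - w * stein_sol x w\<bar> \<le> (\<bar>w\<bar> + 7 / 10) * \<bar>v - w\<bar>"
proof -
  have "v * stein_sol x v - w * stein_sol x w =
      (v - w) * stein_sol x v + w * (stein_sol x v - stein_sol x w)"
    by (simp add: algebra_simps)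
  also have "\<bar>\<dots>\<bar> \<le> \<bar>v - w\<bar> * \<bar>stein_sol x v\<bar> + \<bar>w\<bar> * \<bar>stein_sol x v - stein_sol x w\<bar>"
    unfolding abs_mult[symmetric] by (rule abs_triangle_ineq)
  also have "\<dots> \<le> \<bar>v - w\<bar> * (7 / 10) + \<bar>w\<bar> * \<bar>v - w\<bar>"
    using stein_sol_le[of x v] stein_sol_nonneg[of x v]
    by (intro add_mono mult_left_mono stein_sol_Lipschitz) auto
  finally show ?thesis by (simp add: algebra_simps)
qed

section \<open>First-order Taylor remainders of the Stein solution\<close>

lemma mult_stein_sol_diff_le: "w * stein_sol x w - v * stein_sol x v \<le> 1"
  using mult_stein_sol_le[of w x] mult_stein_sol_ge[of x v] by linarith

text \<open>The derivative of \<open>stein_prim x\<close> is increasing (remainder nonnegative), has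
  variation at most 1 (at most |y|) and is Lipschitz around w (at most quadratic).\<close>

lemma stein_prim_remainder_bounds:
  "0 \<le> stein_prim x (w + y) - stein_prim x w - y * (w * stein_sol x w)"
  "stein_prim x (w + y) - stein_prim x w - y * (w * stein_sol x w) \<le> \<bar>y\<bar>"
  "stein_prim x (w + y) - stein_prim x w - y * (w * stein_sol x w) \<le> (\<bar>w\<bar> + 7 / 10) / 2 * y\<^sup>2"
proof -
  define g where "g = (\<lambda>w. w * stein_sol x w)"
  have g_mono: "u \<le> v \<Longrightarrow> g u \<le> g v" for u v
    using mono_mult_stein_sol[of x] by (auto simp: g_def mono_def)
  \<comment> \<open>One comparison function for all three bounds: \<open>c\<close> offsets the
    increment of \<open>g\<close> by the variation bound, \<open>k\<close> by the Lipschitz bound.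
    Each claim compares \<open>h c k\<close> at w and at w + y.\<close>
  define h where "h = (\<lambda>c k s. stein_prim x s - g w * s - c * s - k / 2 * (s - w)\<^sup>2)"
  have dh: "(h c k has_real_derivative g s - g w - c - k * (s - w)) (at s)" for c k s
    unfolding h_def
    by (rule derivative_eq_intros DERIV_stein_prim refl)+ (simp add: g_def)
  have up: "h c k u \<le> h c k v" if "u \<le> v" "\<And>s. u \<le> s \<Longrightarrow> s \<le> v \<Longrightarrow> 0 \<le> g s - g w - c - k * (s - w)"
    for c k u v
    by (rule DERIV_nonneg_imp_nondecreasing[OF that(1)]) (use dh that(2) in blast)
  have down: "h c k v \<le> h c k u" if "u \<le> v" "\<And>s. u \<le> s \<Longrightarrow> s \<le> v \<Longrightarrow> g s - g w - c - k * (s - w) \<le> 0"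
    for c k u v
    by (rule DERIV_nonpos_imp_nonincreasing[OF that(1)]) (use dh that(2) in blast)
  define K where "K = \<bar>w\<bar> + 7 / 10"
  have lip: "\<bar>g s - g w\<bar> \<le> K * \<bar>s - w\<bar>" for s
    unfolding g_def K_def by (rule mult_stein_sol_Lipschitz)
  have one: "g u - g v \<le> 1" for u v
    unfolding g_def by (rule mult_stein_sol_diff_le)
  have "h 0 0 w \<le> h 0 0 (w + y) \<and> h (sgn y) 0 (w + y) \<le> h (sgn y) 0 w \<and> h 0 K (w + y) \<le> h 0 K w"
  proof (cases "y \<ge> 0")
    case True
    then have "h 0 0 w \<le> h 0 0 (w + y)" by (intro up) (auto intro: g_mono)
    moreover have "h (sgn y) 0 (w + y) \<le> h (sgn y) 0 w"
    proof (cases "y = 0")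
      case False
      then show ?thesis using True one by (intro down) (auto simp: sgn_if algebra_simps)
    qed simp
    moreover have "h 0 K (w + y) \<le> h 0 K w"
    proof (rule down)
      fix s assume "w \<le> s"
      then show "g s - g w - 0 - K * (s - w) \<le> 0" using lip[of s] by simp
    qed (use True in simp)
    ultimately show ?thesis by simp
  next
    case False
    then have "h 0 0 w \<le> h 0 0 (w + y)" by (intro down) (auto intro: g_mono)
    moreover have "h (sgn y) 0 (w + y) \<le> h (sgn y) 0 w"
      using False one[of w] by (intro up) (auto simp: sgn_if algebra_simps)
    moreover have "h 0 K (w + y) \<le> h 0 K w"
    proof (rule up)
      fix s assume "s \<le> w"
      then show "0 \<le> g s - g w - 0 - K * (s - w)" using lip[of s] by (simp add: algebra_simps)
    qed (use False in simp)
    ultimately show ?thesis by simp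
  qed
  then have "h 0 0 w \<le> h 0 0 (w + y)" "h (sgn y) 0 (w + y) \<le> h (sgn y) 0 w"
    "h 0 K (w + y) \<le> h 0 K w" by auto
  note h_le = this
  have "sgn y * (w + y) - sgn y * w = \<bar>y\<bar>"
    by (simp add: sgn_if algebra_simps)
  with h_le(2) show "stein_prim x (w + y) - stein_prim x w - y * (w * stein_sol x w) \<le> \<bar>y\<bar>"
    unfolding h_def g_def by (simp add: algebra_simps)
  show "0 \<le> stein_prim x (w + y) - stein_prim x w - y * (w * stein_sol x w)"
    using h_le(1) unfolding h_def g_def by (simp add: algebra_simps)
  show "stein_prim x (w + y) - stein_prim x w - y * (w * stein_sol x w) \<le> (\<bar>w\<bar> + 7 / 10) / 2 * y\<^sup>2"
    using h_le(3) unfolding h_def g_def K_def[symmetric] by (simp add: algebra_simps)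
qed

text \<open>Minus the Taylor remainder of the concave function \<open>min w x\<close> for the step
  y. As a function of w it is a right triangle of height and base |y| with one corner at x.\<close>

definition stein_tri :: "real \<Rightarrow> real \<Rightarrow> real \<Rightarrow> real" where
  "stein_tri x y w = (if w < x then max 0 (w + y - x) else max 0 (x - w - y))"

text \<open>R is a convex remainder minus \<open>stein_tri\<close>, both nonnegative, so either one
  bounds R on its own side. At the kink w = x the slope is taken from the right, which makes the
  event in question W < x with strict inequality.\<close>

lemma stein_remainder_bounds:
  fixes x w y :: real
  defines "R \<equiv> stein_sol x (w + y) - stein_sol x w
    - y * (w * stein_sol x w + (if w < x then 1 else 0) - \<Phi> x)"
  shows "- stein_tri x y w \<le> R" "R \<le> \<bar>y\<bar>" "R \<le> (\<bar>w\<bar> + 7 / 10) / 2 * y\<^sup>2"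
proof -
  have "R = (stein_prim x (w + y) - stein_prim x w - y * (w * stein_sol x w)) - stein_tri x y w"
    unfolding R_def stein_prim_def stein_tri_def
    by (auto simp: algebra_simps min_def max_def)
  moreover have "0 \<le> stein_tri x y w" by (simp add: stein_tri_def)
  ultimately show "- stein_tri x y w \<le> R" "R \<le> \<bar>y\<bar>" "R \<le> (\<bar>w\<bar> + 7 / 10) / 2 * y\<^sup>2"
    using stein_prim_remainder_bounds[of x w y] by linarith+
qed

lemma borel_measurable_stein_sol [measurable]: "stein_sol x \<in> borel_measurable borel"
proof -
  have "stein_sol x = (\<lambda>w. stein_prim x w + min w x - \<Phi> x * w)"
    by (simp add: fun_eq_iff stein_prim_def)
  moreover have "stein_prim x \<in> borel_measurable borel"
    by (intro borel_measurable_continuous_onI continuous_at_imp_continuous_on ballI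
        DERIV_isCont[OF DERIV_stein_prim])
  ultimately show ?thesis by simp
qed

lemma stein_tri_nonneg: "0 \<le> stein_tri x y w"
  by (simp add: stein_tri_def)

lemma stein_tri_le: "stein_tri x y w \<le> \<bar>y\<bar>"
  by (auto simp: stein_tri_def)

lemma borel_measurable_stein_tri [measurable]: "stein_tri x y \<in> borel_measurable borel"
  unfolding stein_tri_def by measurable

text \<open>Layer-cake representation: if w lies at distance c from x on the relevant side, the
  intervals of length s contain w exactly for s >= c, and |y| - c is the height of the triangle.
  Expectations thereby reduce to interval probabilities.\<close>

lemma stein_tri_le_nn_integral:
  "ennreal (stein_tri x y w) \<le>
     (\<integral>\<^sup>+ s. indicator {0..\<bar>y\<bar>} s * indicator (if y \<ge> 0 then {x - s..x} else {x..x + s}) w \<partial>lborel)"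
proof -
  define c where "c = (if y \<ge> 0 then x - w else w - x)"
  show ?thesis
  proof (cases "0 \<le> c \<and> c \<le> \<bar>y\<bar>")
    case True
    have "ennreal (stein_tri x y w) \<le> ennreal (\<bar>y\<bar> - c)"
      by (rule ennreal_leI) (use True in \<open>auto simp: stein_tri_def c_def split: if_splits\<close>)
    also have "\<dots> = emeasure lborel {c..\<bar>y\<bar>}" using True by simp
    also have "\<dots> = (\<integral>\<^sup>+ s. indicator {c..\<bar>y\<bar>} s \<partial>lborel)" by simp
    also have "\<dots> \<le> (\<integral>\<^sup>+ s. indicator {0..\<bar>y\<bar>} s * indicator (if y \<ge> 0 then {x - s..x} else {x..x + s}) w \<partial>lborel)"
      by (intro nn_integral_mono) (use True in \<open>auto simp: c_def indicator_def split: if_splits\<close>)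
    finally show ?thesis .
  next
    case False
    then have "stein_tri x y w = 0"
      by (auto simp: stein_tri_def c_def split: if_splits)
    then show ?thesis by simp
  qed
qed

section \<open>Normal approximation from a compound Poisson Stein identity\<close>

text \<open>The primitive of the slope \<open>max 0 (1 - s / d)\<close> that vanishes at 0.\<close>

definition ramp :: "real \<Rightarrow> real \<Rightarrow> real" where
  "ramp d u = min u d - (min u d)\<^sup>2 / (2 * d)"

lemma ramp_0 [simp]: "d > 0 \<Longrightarrow> ramp d 0 = 0"
  by (simp add: ramp_def)

lemma ramp_eq: "d > 0 \<Longrightarrow> ramp d u = d / 2 - (d - min u d)\<^sup>2 / (2 * d)"
  by (simp add: ramp_def field_simps power2_eq_square)

lemma ramp_le: "d > 0 \<Longrightarrow> ramp d u \<le> d / 2"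
  by (simp add: ramp_eq)

lemma ramp_mono: "d > 0 \<Longrightarrow> u \<le> v \<Longrightarrow> ramp d u \<le> ramp d v"
  unfolding ramp_eq by (auto intro!: divide_right_mono power_mono)

lemma ramp_nonneg: "d > 0 \<Longrightarrow> 0 \<le> u \<Longrightarrow> 0 \<le> ramp d u"
  using ramp_mono[of d 0 u] by simp

lemma ramp_ge:
  assumes "d > 0" shows "u - u\<^sup>2 / (2 * d) \<le> ramp d u"
proof -
  have "u - u\<^sup>2 / (2 * d) = d / 2 - (d - u)\<^sup>2 / (2 * d)"
    using assms by (simp add: field_simps power2_eq_square)
  also have "\<dots> \<le> ramp d u"
    using assms by (auto simp: ramp_eq min_def)
  finally show ?thesis .
qed

lemma borel_measurable_ramp [measurable]: "ramp d \<in> borel_measurable borel"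
  unfolding ramp_def by measurable

text \<open>Slope 1 on \<open>{a..b}\<close>, decreasing linearly to 0 over a distance \<open>d\<close> on both sides.\<close>

definition conc_test :: "real \<Rightarrow> real \<Rightarrow> real \<Rightarrow> real \<Rightarrow> real" where
  "conc_test a b d w = max a (min b w) - (a + b) / 2
     + ramp d (max 0 (w - b)) - ramp d (max 0 (a - w))"

lemma borel_measurable_conc_test [measurable]: "conc_test a b d \<in> borel_measurable borel"
  unfolding conc_test_def by measurable

lemma conc_test_mono:
  assumes "d > 0" "u \<le> v" shows "conc_test a b d u \<le> conc_test a b d v"
proof -
  have "ramp d (max 0 (u - b)) \<le> ramp d (max 0 (v - b))"
    "ramp d (max 0 (a - v)) \<le> ramp d (max 0 (a - u))"
    using assms by (auto intro!: ramp_mono)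
  moreover have "max a (min b u) \<le> max a (min b v)" using assms by auto
  ultimately show ?thesis unfolding conc_test_def by linarith
qed

lemma conc_test_bound:
  assumes "d > 0" "a \<le> b" shows "\<bar>conc_test a b d w\<bar> \<le> (b - a + d) / 2"
proof -
  have "0 \<le> ramp d (max 0 (w - b))" "0 \<le> ramp d (max 0 (a - w))"
    "ramp d (max 0 (w - b)) \<le> d / 2" "ramp d (max 0 (a - w)) \<le> d / 2"
    using assms by (auto intro!: ramp_nonneg simp del: le_divide_eq_numeral1 intro: ramp_le)
  then show ?thesis using assms
    by (auto simp: conc_test_def abs_le_iff max_def min_def field_simps split: if_splits)
qed

text \<open>At distance s from w in {a..b} the slope is at least 1 - s / d, and integrating over a
  step of length |y| gives |y| - y^2 / (2d).\<close>

lemma conc_test_increment: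
  assumes "d > 0" "a \<le> w" "w \<le> b"
  shows "y\<^sup>2 - \<bar>y\<bar> ^ 3 / (2 * d) \<le> y * (conc_test a b d (w + y) - conc_test a b d w)"
proof -
  \<comment> \<open>Here \<open>e\<close> is the portion of the step that stays inside {a..b}; the
    worst case is a start at the endpoint, e = 0.\<close>
  have step: "u - u\<^sup>2 / (2 * d) \<le> e + ramp d (u - e)" if "0 \<le> e" "e \<le> u" for u e
  proof -
    have "(u - e)\<^sup>2 \<le> u\<^sup>2" using that by (intro power_mono) auto
    then have "(u - e)\<^sup>2 / (2 * d) \<le> u\<^sup>2 / (2 * d)" using assms by (intro divide_right_mono) auto
    then show ?thesis using ramp_ge[OF assms(1), of "u - e"] by linarith
  qed
  have pos: "0 \<le> u\<^sup>2 / (2 * d)" for u using assms by simp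
  have w: "conc_test a b d w = w - (a + b) / 2" using assms by (simp add: conc_test_def)
  show ?thesis
  proof (cases "y \<ge> 0")
    case True
    have "y - y\<^sup>2 / (2 * d) \<le> conc_test a b d (w + y) - conc_test a b d w"
      using step[of "b - w" y] pos[of y] assms True unfolding w
      by (cases "w + y \<le> b") (auto simp: conc_test_def algebra_simps)
    then have "y * (y - y\<^sup>2 / (2 * d)) \<le> y * (conc_test a b d (w + y) - conc_test a b d w)"
      using True by (rule mult_left_mono)
    then show ?thesis using True by (simp add: algebra_simps power2_eq_square power3_eq_cube)
  next
    case False
    have "- y - y\<^sup>2 / (2 * d) \<le> conc_test a b d w - conc_test a b d (w + y)"
      using step[of "w - a" "- y"] pos[of y] assms False unfolding w
      by (cases "a \<le> w + y") (auto simp: conc_test_def algebra_simps)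
    then have "- y * (- y - y\<^sup>2 / (2 * d)) \<le> - y * (conc_test a b d w - conc_test a b d (w + y))"
      using False by (intro mult_left_mono) auto
    then show ?thesis using False by (simp add: algebra_simps power2_eq_square power3_eq_cube)
  qed
qed

section \<open>The Stein identity and truncated moments\<close>

lemma abs_cube_le: "\<bar>y\<bar> \<le> 1 \<Longrightarrow> \<bar>y\<bar> ^ 3 \<le> y\<^sup>2" for y :: real
  using mult_right_mono[of "\<bar>y\<bar>" 1 "y\<^sup>2"] by (simp add: power3_eq_cube power2_eq_square)

text \<open>Isolates what the analysis needs from the random sum: \<open>m\<close> is the law of W
  and \<open>\<mu>\<close> that of one normalized summand. For W itself only a first moment is
  assumed.\<close>

locale compound_poisson_stein = m: real_distribution m + \<mu>: real_distribution \<mu>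
  for m \<mu> :: "real measure" +
  fixes l :: real
  assumes l_pos: "l > 0"
    and integrable_m: "integrable m (\<lambda>w. w)"
    and integrable_\<mu>: "integrable \<mu> (\<lambda>y. y)"
    and integrable_\<mu>2: "integrable \<mu> (\<lambda>y. y\<^sup>2)"
    and mean_0: "(\<integral>y. y \<partial>\<mu>) = 0"
    and variance_1: "l * (\<integral>y. y\<^sup>2 \<partial>\<mu>) = 1"
    and mecke: "\<And>f B. f \<in> borel_measurable borel \<Longrightarrow> (\<And>w. \<bar>f w\<bar> \<le> B) \<Longrightarrow>
      (\<integral>w. w * f w \<partial>m) = l * (\<integral>y. y * (\<integral>w. f (w + y) \<partial>m) \<partial>\<mu>)"
begin

text \<open>After normalization \<open>min 1 \<bar>y\<bar>\<close> switches at |y| = 1. The two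
  parts of L are kept apart because they enter the estimates with different weights.\<close>

definition \<beta>2 :: real where "\<beta>2 = l * (\<integral>y. (if \<bar>y\<bar> \<le> 1 then 0 else y\<^sup>2) \<partial>\<mu>)"
definition \<beta>3 :: real where "\<beta>3 = l * (\<integral>y. (if \<bar>y\<bar> \<le> 1 then \<bar>y\<bar> ^ 3 else 0) \<partial>\<mu>)"

lemma integrable_truncated:
  assumes [measurable]: "h \<in> borel_measurable borel" and "\<And>y. \<bar>h y\<bar> \<le> c * y\<^sup>2"
  shows "integrable \<mu> h"
proof (rule Bochner_Integration.integrable_bound)
  show "integrable \<mu> (\<lambda>y. c * y\<^sup>2)" using integrable_\<mu>2 by simp
  show "AE y in \<mu>. norm (h y) \<le> norm (c * y\<^sup>2)"
    using order_trans[OF assms(2) abs_ge_self] by simp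
qed simp

lemma integrable_pieces:
  "integrable \<mu> (\<lambda>y. if \<bar>y\<bar> \<le> 1 then 0 else y\<^sup>2)"
  "integrable \<mu> (\<lambda>y. if \<bar>y\<bar> \<le> 1 then y\<^sup>2 else 0)"
  "integrable \<mu> (\<lambda>y. if \<bar>y\<bar> \<le> 1 then \<bar>y\<bar> ^ 3 else 0)"
  by (auto intro!: integrable_truncated[where c = 1] simp: abs_cube_le)

lemma integral_small_square: "l * (\<integral>y. (if \<bar>y\<bar> \<le> 1 then y\<^sup>2 else 0) \<partial>\<mu>) = 1 - \<beta>2"
proof -
  have "(\<integral>y. y\<^sup>2 \<partial>\<mu>) = (\<integral>y. (if \<bar>y\<bar> \<le> 1 then y\<^sup>2 else 0) + (if \<bar>y\<bar> \<le> 1 then 0 else y\<^sup>2) \<partial>\<mu>)"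
    by (intro Bochner_Integration.integral_cong) auto
  also have "\<dots> = (\<integral>y. (if \<bar>y\<bar> \<le> 1 then y\<^sup>2 else 0) \<partial>\<mu>) + (\<integral>y. (if \<bar>y\<bar> \<le> 1 then 0 else y\<^sup>2) \<partial>\<mu>)"
    by (intro Bochner_Integration.integral_add integrable_pieces)
  finally show ?thesis using variance_1 by (simp add: \<beta>2_def algebra_simps)
qed

lemma \<beta>2_nonneg: "0 \<le> \<beta>2"
  unfolding \<beta>2_def using l_pos by (intro mult_nonneg_nonneg Bochner_Integration.integral_nonneg) auto

lemma \<beta>3_nonneg: "0 \<le> \<beta>3"
  unfolding \<beta>3_def using l_pos by (intro mult_nonneg_nonneg Bochner_Integration.integral_nonneg) auto

lemma \<beta>2_plus_\<beta>3: "\<beta>2 + \<beta>3 = l * (\<integral>y. y\<^sup>2 * min 1 \<bar>y\<bar> \<partial>\<mu>)"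
proof -
  have "(\<integral>y. y\<^sup>2 * min 1 \<bar>y\<bar> \<partial>\<mu>)
      = (\<integral>y. (if \<bar>y\<bar> \<le> 1 then 0 else y\<^sup>2) + (if \<bar>y\<bar> \<le> 1 then \<bar>y\<bar> ^ 3 else 0) \<partial>\<mu>)"
    by (intro Bochner_Integration.integral_cong)
      (auto simp: power2_eq_square power3_eq_cube)
  also have "\<dots> = (\<integral>y. (if \<bar>y\<bar> \<le> 1 then 0 else y\<^sup>2) \<partial>\<mu>) + (\<integral>y. (if \<bar>y\<bar> \<le> 1 then \<bar>y\<bar> ^ 3 else 0) \<partial>\<mu>)"
    by (intro Bochner_Integration.integral_add integrable_pieces)
  finally show ?thesis by (simp add: \<beta>2_def \<beta>3_def algebra_simps)
qed

text \<open>Otherwise the summands would vanish almost surely, against the variance. Positivity is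
  needed because L becomes the margin width.\<close>

lemma \<beta>2_plus_\<beta>3_pos: "0 < \<beta>2 + \<beta>3"
proof (rule ccontr)
  assume "\<not> 0 < \<beta>2 + \<beta>3"
  then have "\<beta>2 + \<beta>3 = 0" using \<beta>2_nonneg \<beta>3_nonneg by simp
  then have 0: "(\<integral>y. y\<^sup>2 * min 1 \<bar>y\<bar> \<partial>\<mu>) = 0" using l_pos by (simp add: \<beta>2_plus_\<beta>3)
  have "integrable \<mu> (\<lambda>y. y\<^sup>2 * min 1 \<bar>y\<bar>)"
    by (rule integrable_truncated[where c = 1])
      (auto simp: abs_mult intro!: mult_left_le)
  then have "AE y in \<mu>. y\<^sup>2 * min 1 \<bar>y\<bar> = 0"
    using integral_nonneg_eq_0_iff_AE[of \<mu> "\<lambda>y. y\<^sup>2 * min 1 \<bar>y\<bar>"] 0 by simp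
  then have "(\<integral>y. y\<^sup>2 \<partial>\<mu>) = (\<integral>y. 0 \<partial>\<mu>)"
    by (intro integral_cong_AE) (auto simp: min_def split: if_splits)
  then show False using variance_1 by simp
qed

lemma m_bounded_integrable:
  fixes f :: "real \<Rightarrow> real"
  assumes [measurable]: "f \<in> borel_measurable borel" and "\<And>w. \<bar>f w\<bar> \<le> B"
  shows "integrable m f"
  by (rule m.integrable_const_bound[where B = B]) (use assms in auto)

lemma m_integrable_indicator: "S \<in> sets borel \<Longrightarrow> integrable m (indicat_real S)"
  by (rule m_bounded_integrable[where B = 1]) (auto simp: indicator_def)

lemma mult_m_bounded_integrable:
  fixes f :: "real \<Rightarrow> real"
  assumes [measurable]: "f \<in> borel_measurable borel" and B: "\<And>w. \<bar>f w\<bar> \<le> B"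
  shows "integrable m (\<lambda>w. w * f w)"
proof (rule Bochner_Integration.integrable_bound)
  show "integrable m (\<lambda>w. B * w)" using integrable_m by simp
  have "\<bar>w\<bar> * \<bar>f w\<bar> \<le> \<bar>w\<bar> * \<bar>B\<bar>" for w
    using B[of w] by (intro mult_left_mono) auto
  then show "AE w in m. norm (w * f w) \<le> norm (B * w)" by (simp add: abs_mult mult.commute)
qed simp

text \<open>As \<open>\<mu>\<close> has mean 0, \<open>f w\<close> may be subtracted inside. For
  monotone f the integrand then has a sign, and in general it only involves increments.\<close>

lemma
  assumes f[measurable]: "f \<in> borel_measurable borel" and B: "\<And>w. \<bar>f w\<bar> \<le> B"
  shows stein_identity: "(\<integral>w. w * f w \<partial>m) = l * (\<integral>y. y * (\<integral>w. f (w + y) - f w \<partial>m) \<partial>\<mu>)"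
    and stein_integrable: "integrable \<mu> (\<lambda>y. y * (\<integral>w. f (w + y) - f w \<partial>m))"
proof -
  have i: "integrable m (\<lambda>w. f (w + y))" for y
    by (rule m_bounded_integrable) (use B in auto)
  have eq: "(\<integral>w. f (w + y) - f w \<partial>m) = (\<integral>w. f (w + y) \<partial>m) - (\<integral>w. f w \<partial>m)" for y
    using i[of y] i[of 0] by simp
  have bound: "\<bar>\<integral>w. f (w + y) \<partial>m\<bar> \<le> B" for y
  proof -
    have "\<bar>\<integral>w. f (w + y) \<partial>m\<bar> \<le> (\<integral>w. \<bar>f (w + y)\<bar> \<partial>m)"
      by (rule integral_abs_bound)
    also have "\<dots> \<le> (\<integral>w. B \<partial>m)" using i B by (intro integral_mono) auto
    finally show ?thesis using m.prob_space by simp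
  qed
  have 1: "integrable \<mu> (\<lambda>y. y * (\<integral>w. f (w + y) \<partial>m))"
  proof (rule Bochner_Integration.integrable_bound)
    show "integrable \<mu> (\<lambda>y. B * y)" using integrable_\<mu> by simp
    show "(\<lambda>y. y * (\<integral>w. f (w + y) \<partial>m)) \<in> borel_measurable \<mu>" by measurable
    have "\<bar>y\<bar> * \<bar>\<integral>w. f (w + y) \<partial>m\<bar> \<le> \<bar>y\<bar> * \<bar>B\<bar>" for y
      using bound[of y] by (intro mult_left_mono) auto
    then show "AE y in \<mu>. norm (y * (\<integral>w. f (w + y) \<partial>m)) \<le> norm (B * y)"
      by (simp add: abs_mult mult.commute)
  qed
  show "integrable \<mu> (\<lambda>y. y * (\<integral>w. f (w + y) - f w \<partial>m))"
    unfolding eq right_diff_distrib using 1 integrable_\<mu> by simp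
  show "(\<integral>w. w * f w \<partial>m) = l * (\<integral>y. y * (\<integral>w. f (w + y) - f w \<partial>m) \<partial>\<mu>)"
    unfolding eq right_diff_distrib mecke[OF f B] using 1 integrable_\<mu>
    by (simp add: mean_0)
qed

text \<open>The identity admits bounded test functions only, so the second moment of W is replaced
  by E W f(W) with f the identity clipped at 2. As f is 1-Lipschitz, this is at most 1. Still 2|w|
  <= 1 + w f(w): by a square for |w| <= 2, and because w f(w) = 2|w| beyond.\<close>

lemma expectation_abs_le_1: "(\<integral>w. \<bar>w\<bar> \<partial>m) \<le> 1"
proof -
  define f :: "real \<Rightarrow> real" where "f w = max (- 2) (min 2 w)" for w
  have f[measurable]: "f \<in> borel_measurable borel" and B: "\<bar>f w\<bar> \<le> 2" for w
    unfolding f_def by auto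
  note si = stein_integrable[OF f B]
  have i: "integrable m (\<lambda>w. y * (f (w + y) - f w))" for y
    by (intro integrable_mult_right Bochner_Integration.integrable_diff m_bounded_integrable[where B = 2])
      (auto intro: B)
  have "y * (\<integral>w. f (w + y) - f w \<partial>m) \<le> y\<^sup>2" for y
  proof -
    have "y * (\<integral>w. f (w + y) - f w \<partial>m) = (\<integral>w. y * (f (w + y) - f w) \<partial>m)" by simp
    also have "\<dots> \<le> (\<integral>w. y\<^sup>2 \<partial>m)"
    proof (intro integral_mono i)
      fix w
      have "\<bar>y\<bar> * \<bar>f (w + y) - f w\<bar> \<le> \<bar>y\<bar> * \<bar>y\<bar>"
        by (intro mult_left_mono) (auto simp: f_def)
      then show "y * (f (w + y) - f w) \<le> y\<^sup>2"
        using abs_ge_self[of "y * (f (w + y) - f w)"] by (simp add: abs_mult power2_eq_square)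
    qed simp
    finally show ?thesis using m.prob_space by simp
  qed
  then have "(\<integral>y. y * (\<integral>w. f (w + y) - f w \<partial>m) \<partial>\<mu>) \<le> (\<integral>y. y\<^sup>2 \<partial>\<mu>)"
    using si integrable_\<mu>2 by (intro integral_mono) auto
  then have "l * (\<integral>y. y * (\<integral>w. f (w + y) - f w \<partial>m) \<partial>\<mu>) \<le> 1"
    unfolding variance_1[symmetric] using l_pos by (intro mult_left_mono) auto
  then have le1: "(\<integral>w. w * f w \<partial>m) \<le> 1"
    unfolding stein_identity[OF f B] .
  have "(\<integral>w. \<bar>w\<bar> \<partial>m) \<le> (\<integral>w. (1 + w * f w) / 2 \<partial>m)"
  proof (intro integral_mono)
    fix w :: real
    have "0 \<le> (\<bar>w\<bar> - 1)\<^sup>2" by simp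
    then have "2 * \<bar>w\<bar> \<le> 1 + w\<^sup>2" by (simp add: power2_eq_square algebra_simps)
    then show "\<bar>w\<bar> \<le> (1 + w * f w) / 2"
      by (auto simp: f_def max_def min_def power2_eq_square)
  qed (use integrable_m mult_m_bounded_integrable[OF f B] in auto)
  also have "\<dots> = (1 + (\<integral>w. w * f w \<partial>m)) / 2"
    using mult_m_bounded_integrable[OF f B] m.prob_space by simp
  finally show ?thesis using le1 by simp
qed

text \<open>The left side is a lower bound for E W f(W) through increments, the right side an upper
  bound through the supremum of f and E|W| <= 1. Larger margins improve the first and spoil the
  second.\<close>

lemma concentration:
  assumes d: "d > 0" and ab: "a \<le> b"
  shows "m.prob {a..b} * (1 - \<beta>2 - \<beta>3 / (2 * d)) \<le> (b - a + d) / 2"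
proof -
  let ?f = "conc_test a b d" and ?B = "(b - a + d) / 2"
  note f = borel_measurable_conc_test[of a b d] and B = conc_test_bound[OF d ab]
  \<comment> \<open>The minorant from \<open>conc_test_increment\<close> is kept for |y| <= 1 and
    replaced by 0 for larger y, where monotonicity of the test function suffices; no third moment is
    required.\<close>
  define k where "k = (\<lambda>y. (if \<bar>y\<bar> \<le> 1 then y\<^sup>2 else 0) - (if \<bar>y\<bar> \<le> 1 then \<bar>y\<bar> ^ 3 else 0) / (2 * d))"
  have k_int: "integrable \<mu> k"
    unfolding k_def by (intro Bochner_Integration.integrable_diff integrable_divide integrable_pieces)
  have k_val: "l * (\<integral>y. k y \<partial>\<mu>) = 1 - \<beta>2 - \<beta>3 / (2 * d)"
    unfolding k_def integral_small_square[symmetric] \<beta>3_def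
    by (simp add: integrable_pieces right_diff_distrib)
  have "m.prob {a..b} * k y \<le> y * (\<integral>w. ?f (w + y) - ?f w \<partial>m)" for y
  proof -
    have "m.prob {a..b} * k y = (\<integral>w. k y * indicator {a..b} w \<partial>m)"
      by (simp add: mult.commute)
    also have "\<dots> \<le> (\<integral>w. y * (?f (w + y) - ?f w) \<partial>m)"
    proof (intro integral_mono)
      show "integrable m (\<lambda>w. y * (?f (w + y) - ?f w))"
        by (intro integrable_mult_right Bochner_Integration.integrable_diff m_bounded_integrable[where B = ?B])
          (use B in auto)
      fix w
      have "0 \<le> y * (?f (w + y) - ?f w)"
        using conc_test_mono[OF d, of w "w + y" a b] conc_test_mono[OF d, of "w + y" w a b]
        by (cases "y \<ge> 0") (auto simp: mult_nonpos_nonpos)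
      then show "k y * indicator {a..b} w \<le> y * (?f (w + y) - ?f w)"
        using conc_test_increment[OF d, of a w b y] by (auto simp: k_def indicator_def)
    qed (auto intro: m_integrable_indicator)
    finally show ?thesis by simp
  qed
  then have "(\<integral>y. m.prob {a..b} * k y \<partial>\<mu>) \<le> (\<integral>y. y * (\<integral>w. ?f (w + y) - ?f w \<partial>m) \<partial>\<mu>)"
    using stein_integrable[OF f B] k_int by (intro integral_mono) auto
  then have "l * (\<integral>y. m.prob {a..b} * k y \<partial>\<mu>) \<le> (\<integral>w. w * ?f w \<partial>m)"
    unfolding stein_identity[OF f B] using l_pos by (intro mult_left_mono) auto
  also have "\<dots> \<le> (\<integral>w. ?B * \<bar>w\<bar> \<partial>m)"
  proof (intro integral_mono mult_m_bounded_integrable[OF f B])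
    fix w
    have "w * ?f w \<le> \<bar>w\<bar> * \<bar>?f w\<bar>" by (metis abs_ge_self abs_mult)
    also have "\<dots> \<le> \<bar>w\<bar> * ?B" by (intro mult_left_mono B) simp
    finally show "w * ?f w \<le> ?B * \<bar>w\<bar>" by (simp only: mult.commute)
  qed (use integrable_m in simp)
  also have "\<dots> = ?B * (\<integral>w. \<bar>w\<bar> \<partial>m)" by simp
  also have "\<dots> \<le> ?B * 1" using d ab by (intro mult_left_mono expectation_abs_le_1) auto
  finally show ?thesis using k_val by (simp add: mult.left_commute[of l])
qed

section \<open>Expected remainders and the normal approximation bound\<close>

lemma expectation_stein_tri_le_abs: "(\<integral>w. stein_tri x y w \<partial>m) \<le> \<bar>y\<bar>"
proof -
  have "(\<integral>w. stein_tri x y w \<partial>m) \<le> (\<integral>w. \<bar>y\<bar> \<partial>m)"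
    by (intro integral_mono m_bounded_integrable[where B = "\<bar>y\<bar>"])
      (auto simp: stein_tri_le stein_tri_nonneg)
  then show ?thesis using m.prob_space by simp
qed

text \<open>By the layer-cake bound and Fubini, the concentration bound (s + d) / (2D) for an
  interval of length s is integrated over s from 0 to |y|.\<close>

lemma expectation_stein_tri_le:
  assumes d: "d > 0" and D: "D > 0" "D = 1 - \<beta>2 - \<beta>3 / (2 * d)"
  shows "(\<integral>w. stein_tri x y w \<partial>m) \<le> (y\<^sup>2 / 2 + d * \<bar>y\<bar>) / (2 * D)"
proof -
  define I where "I s = (if y \<ge> 0 then {x - s..x} else {x..x + s})" for s
  have conc: "emeasure m (I s) \<le> ennreal ((s + d) / (2 * D))" if "s \<ge> 0" for s
  proof -
    have "m.prob (I s) * D \<le> (s + d) / 2"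
      using concentration[OF d, of "x - s" x] concentration[OF d, of x "x + s"] that
      unfolding I_def D(2) by auto
    then show ?thesis
      unfolding m.emeasure_eq_measure using D(1) by (intro ennreal_leI) (simp add: field_simps)
  qed
  interpret pair_sigma_finite m lborel
    by (simp add: pair_sigma_finite_def lborel.sigma_finite_measure_axioms m.sigma_finite_measure_axioms)
  have meas: "(\<lambda>(w, s). indicator {0..\<bar>y\<bar>} s * indicator (I s) w :: ennreal)
      \<in> borel_measurable (m \<Otimes>\<^sub>M lborel)"
  proof -
    have "(\<lambda>(w, s). indicator {0..\<bar>y\<bar>} s * indicator (I s) w :: ennreal)
      = (\<lambda>(w, s). indicator {0..\<bar>y\<bar>} s *
          (if (if y \<ge> 0 then x - s \<le> w \<and> w \<le> x else x \<le> w \<and> w \<le> x + s) then 1 else 0))"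
      by (auto simp: I_def fun_eq_iff indicator_def)
    then show ?thesis by simp
  qed
  have int: "integrable m (\<lambda>w. stein_tri x y w)"
    by (rule m_bounded_integrable[where B = "\<bar>y\<bar>"]) (auto simp: stein_tri_le stein_tri_nonneg)
  have "ennreal (\<integral>w. stein_tri x y w \<partial>m) = (\<integral>\<^sup>+ w. ennreal (stein_tri x y w) \<partial>m)"
    using int by (intro nn_integral_eq_integral[symmetric]) (auto simp: stein_tri_nonneg)
  also have "\<dots> \<le> (\<integral>\<^sup>+ w. \<integral>\<^sup>+ s. indicator {0..\<bar>y\<bar>} s * indicator (I s) w \<partial>lborel \<partial>m)"
    unfolding I_def by (intro nn_integral_mono stein_tri_le_nn_integral)
  also have "\<dots> = (\<integral>\<^sup>+ s. \<integral>\<^sup>+ w. indicator {0..\<bar>y\<bar>} s * indicator (I s) w \<partial>m \<partial>lborel)"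
    by (rule Fubini'[OF meas, symmetric])
  also have "\<dots> = (\<integral>\<^sup>+ s. indicator {0..\<bar>y\<bar>} s * emeasure m (I s) \<partial>lborel)"
    by (intro nn_integral_cong) (simp add: nn_integral_cmult I_def)
  also have "\<dots> \<le> (\<integral>\<^sup>+ s. ennreal ((s + d) / (2 * D)) * indicator {0..\<bar>y\<bar>} s \<partial>lborel)"
    by (intro nn_integral_mono) (auto simp: indicator_def intro: conc)
  also have "\<dots> = ennreal ((\<bar>y\<bar>\<^sup>2 / 2 + d * \<bar>y\<bar>) / (2 * D) - (0\<^sup>2 / 2 + d * 0) / (2 * D))"
    using d D(1)
    by (intro nn_integral_FTC_Icc[where F = "\<lambda>s. (s\<^sup>2 / 2 + d * s) / (2 * D)"])
      (auto intro!: derivative_eq_intros simp: has_real_derivative_iff_has_vector_derivative[symmetric] field_simps)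
  finally show ?thesis using d D(1) by (subst (asm) ennreal_le_iff) auto
qed

text \<open>The condition D >= 5/17 says that 1 / (4D) <= 17/20: the quadratic coefficient of the
  concave remainder does not exceed that of the convex one.\<close>

lemma normal_approximation_truncated:
  assumes d: "d > 0" and D: "D \<ge> 5 / 17" "D = 1 - \<beta>2 - \<beta>3 / (2 * d)"
  shows "\<bar>m.prob {..<x} - \<Phi> x\<bar> \<le> 17 / 20 * \<beta>3 + d / (2 * D) * (1 - \<beta>2) + \<beta>2"
proof -
  let ?f = "stein_sol x"
  have D0: "D > 0" using D(1) by simp
  have f: "?f \<in> borel_measurable borel" by simp
  have B: "\<bar>?f w\<bar> \<le> 7 / 10" for w
    using stein_sol_nonneg[of x w] stein_sol_le[of x w] by simp
  \<comment> \<open>The derivative of the Stein solution, with its right-hand value at x;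
    \<open>R\<close> below is the corresponding remainder.\<close>
  define p where "p = (\<lambda>w. w * ?f w + indicator {..<x} w - \<Phi> x)"
  have int_wf: "integrable m (\<lambda>w. w * ?f w)" by (rule mult_m_bounded_integrable[OF f B])
  have int_p: "integrable m p"
    unfolding p_def using int_wf
    by (intro Bochner_Integration.integrable_diff Bochner_Integration.integrable_add m_integrable_indicator) auto
  have val_p: "(\<integral>w. p w \<partial>m) = (\<integral>w. w * ?f w \<partial>m) + m.prob {..<x} - \<Phi> x"
    unfolding p_def using int_wf m.prob_space by (simp add: m_integrable_indicator)
  define R where "R = (\<lambda>y w. ?f (w + y) - ?f w - y * p w)"
  have int_df: "integrable m (\<lambda>w. ?f (w + y) - ?f w)" for y
    by (intro Bochner_Integration.integrable_diff m_bounded_integrable[where B = "7 / 10"]) (use B in auto)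
  then have int_R: "integrable m (R y)" for y
    unfolding R_def using int_p by simp
  define Z where "Z y = (\<integral>w. R y w \<partial>m)" for y
  have Z_eq: "y * Z y = y * (\<integral>w. ?f (w + y) - ?f w \<partial>m) - y\<^sup>2 * (\<integral>w. p w \<partial>m)" for y
    unfolding Z_def R_def using int_df int_p by (simp add: right_diff_distrib power2_eq_square)
  have int_Z: "integrable \<mu> (\<lambda>y. y * Z y)"
    unfolding Z_eq using stein_integrable[OF f B] integrable_\<mu>2 by simp
  \<comment> \<open>Inserting the Taylor expansion in the Stein identity, the linear term
    contributes exactly E p(W) because the variance is 1. What remains is E W f(W) - E p(W), the
    Stein equation at W.\<close>
  have "l * (\<integral>y. y * Z y \<partial>\<mu>) = (\<integral>w. w * ?f w \<partial>m) - (\<integral>w. p w \<partial>m) * (l * (\<integral>y. y\<^sup>2 \<partial>\<mu>))"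
    unfolding Z_eq stein_identity[OF f B] using stein_integrable[OF f B] integrable_\<mu>2
    by (simp add: right_diff_distrib)
  also have "\<dots> = \<Phi> x - m.prob {..<x}" unfolding variance_1 val_p by simp
  finally have Z_val: "\<Phi> x - m.prob {..<x} = l * (\<integral>y. y * Z y \<partial>\<mu>)" by simp
  have p_eq: "p w = w * ?f w + (if w < x then 1 else 0) - \<Phi> x" for w
    by (simp add: p_def)
  have R: "- stein_tri x y w \<le> R y w" "R y w \<le> \<bar>y\<bar>" "R y w \<le> (\<bar>w\<bar> + 7 / 10) / 2 * y\<^sup>2" for y w
    unfolding R_def p_eq by (rule stein_remainder_bounds)+
  have int_tri: "integrable m (\<lambda>w. stein_tri x y w)" for y
    by (rule m_bounded_integrable[where B = "\<bar>y\<bar>"]) (auto simp: stein_tri_le stein_tri_nonneg)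
  have Z_lower: "- (\<integral>w. stein_tri x y w \<partial>m) \<le> Z y" for y
    unfolding Z_def using int_R int_tri R(1)
    by (subst Bochner_Integration.integral_minus[symmetric]) (intro integral_mono, auto)
  have Z_upper1: "Z y \<le> \<bar>y\<bar>" for y
  proof -
    have "Z y \<le> (\<integral>w. \<bar>y\<bar> \<partial>m)" unfolding Z_def using int_R R(2) by (intro integral_mono) auto
    then show ?thesis using m.prob_space by simp
  qed
  have Z_upper2: "Z y \<le> 17 / 20 * y\<^sup>2" for y
  proof -
    have "Z y \<le> (\<integral>w. (\<bar>w\<bar> + 7 / 10) / 2 * y\<^sup>2 \<partial>m)"
      unfolding Z_def using int_R R(3) integrable_m by (intro integral_mono) auto
    also have "\<dots> = ((\<integral>w. \<bar>w\<bar> \<partial>m) + 7 / 10) / 2 * y\<^sup>2"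
      using integrable_m m.prob_space by simp
    also have "\<dots> \<le> (1 + 7 / 10) / 2 * y\<^sup>2"
      by (intro mult_right_mono divide_right_mono add_right_mono expectation_abs_le_1) auto
    finally show ?thesis by simp
  qed
  \<comment> \<open>Majorant of |y * Z y|: the refined estimate for |y| <= 1, the crude |Z y| <= |y|
    otherwise.\<close>
  define h where "h = (\<lambda>y. 17 / 20 * (if \<bar>y\<bar> \<le> 1 then \<bar>y\<bar> ^ 3 else 0)
    + d / (2 * D) * (if \<bar>y\<bar> \<le> 1 then y\<^sup>2 else 0) + (if \<bar>y\<bar> \<le> 1 then 0 else y\<^sup>2))"
  have int_h: "integrable \<mu> h" unfolding h_def
    by (intro Bochner_Integration.integrable_add integrable_mult_right integrable_pieces)
  have "l * (\<integral>y. h y \<partial>\<mu>)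
      = 17 / 20 * \<beta>3 + d / (2 * D) * (l * (\<integral>y. (if \<bar>y\<bar> \<le> 1 then y\<^sup>2 else 0) \<partial>\<mu>)) + \<beta>2"
    unfolding h_def \<beta>2_def \<beta>3_def
    by (simp add: integrable_pieces distrib_left mult.left_commute[of l])
  then have val_h: "l * (\<integral>y. h y \<partial>\<mu>) = 17 / 20 * \<beta>3 + d / (2 * D) * (1 - \<beta>2) + \<beta>2"
    unfolding integral_small_square .
  have Z_le: "\<bar>y * Z y\<bar> \<le> h y" for y
  proof -
    have "\<bar>Z y\<bar> \<le> \<bar>y\<bar>"
      using Z_upper1[of y] Z_lower[of y] expectation_stein_tri_le_abs[of x y] by linarith
    then have 1: "\<bar>y * Z y\<bar> \<le> y\<^sup>2"
      using mult_left_mono[of "\<bar>Z y\<bar>" "\<bar>y\<bar>" "\<bar>y\<bar>"] by (simp add: abs_mult power2_eq_square)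
    have "(y\<^sup>2 / 2 + d * \<bar>y\<bar>) / (2 * D) = y\<^sup>2 * (1 / (4 * D)) + d / (2 * D) * \<bar>y\<bar>"
      by (simp add: add_divide_distrib)
    also have "\<dots> \<le> y\<^sup>2 * (17 / 20) + d / (2 * D) * \<bar>y\<bar>"
      using D(1) by (intro add_right_mono mult_left_mono) (auto simp: field_simps)
    finally have "(\<integral>w. stein_tri x y w \<partial>m) \<le> y\<^sup>2 * (17 / 20) + d / (2 * D) * \<bar>y\<bar>"
      using expectation_stein_tri_le[OF d D0 D(2), of x y] by (rule order_trans[rotated])
    moreover have "0 \<le> d / (2 * D) * \<bar>y\<bar>" using d D0 by simp
    ultimately have "\<bar>Z y\<bar> \<le> 17 / 20 * y\<^sup>2 + d / (2 * D) * \<bar>y\<bar>"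
      using Z_upper2[of y] Z_lower[of y] unfolding abs_le_iff by linarith
    then have "\<bar>y\<bar> * \<bar>Z y\<bar> \<le> \<bar>y\<bar> * (17 / 20 * y\<^sup>2 + d / (2 * D) * \<bar>y\<bar>)"
      by (intro mult_left_mono) auto
    also have "\<dots> = 17 / 20 * \<bar>y\<bar> ^ 3 + d / (2 * D) * y\<^sup>2"
      unfolding power2_abs[of y, symmetric] by (simp add: algebra_simps power2_eq_square power3_eq_cube)
    finally show ?thesis using 1 by (simp add: h_def abs_mult)
  qed
  have "\<bar>\<integral>y. y * Z y \<partial>\<mu>\<bar> \<le> (\<integral>y. \<bar>y * Z y\<bar> \<partial>\<mu>)" by (rule integral_abs_bound)
  also have "\<dots> \<le> (\<integral>y. h y \<partial>\<mu>)"
    using int_Z int_h Z_le by (intro integral_mono) auto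
  finally have "l * \<bar>\<integral>y. y * Z y \<partial>\<mu>\<bar> \<le> 17 / 20 * \<beta>3 + d / (2 * D) * (1 - \<beta>2) + \<beta>2"
    unfolding val_h[symmetric] using l_pos by (intro mult_left_mono) auto
  then show ?thesis
    using Z_val l_pos by (simp add: abs_mult abs_minus_commute)
qed

theorem normal_approximation:
  "\<bar>m.prob {..<x} - \<Phi> x\<bar> \<le> 1.8546 * (l * (\<integral>y. y\<^sup>2 * min 1 \<bar>y\<bar> \<partial>\<mu>))"
proof -
  define L where "L = \<beta>2 + \<beta>3"
  \<comment> \<open>The share of L due to large summands; the final inequality then lives in the two
    variables r and L.\<close>
  define r where "r = \<beta>2 / L"
  have L0: "L > 0" unfolding L_def by (rule \<beta>2_plus_\<beta>3_pos)
  have r: "0 \<le> r" "r \<le> 1" and \<beta>2: "\<beta>2 = r * L" and \<beta>3: "\<beta>3 = (1 - r) * L"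
    using \<beta>2_nonneg \<beta>3_nonneg L0 by (auto simp: r_def L_def field_simps)
  have "\<bar>m.prob {..<x} - \<Phi> x\<bar> \<le> 1.8546 * L"
  \<comment> \<open>Since 1.8546 * 27/50 > 1, larger L make the claim trivial.\<close>
  proof (cases "L < 27 / 50")
    case False
    have "\<bar>m.prob {..<x} - \<Phi> x\<bar> \<le> 1"
      using m.prob_le_1[of "{..<x}"] measure_nonneg[of m "{..<x}"]
        std_normal_cdf_range[of x] unfolding abs_le_iff by linarith
    then show ?thesis using False by simp
  next
    case L: True
    \<comment> \<open>Twice the factor D for the margin width d = L, where \<open>\<beta>3\<close> /
      (2d) becomes (1 - r)/2.\<close>
    define E where "E = 1 + r - 2 * (r * L)"
    have rL: "r * L \<le> r * (27 / 50)" using L r by (intro mult_left_mono) auto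
    have E: "E \<ge> 10 / 17" using rL r unfolding E_def by linarith
    have E_eq: "E / 2 = 1 - \<beta>2 - \<beta>3 / (2 * L)"
      using L0 by (simp add: E_def \<beta>2 \<beta>3 field_simps)
    \<comment> \<open>The left side is affine in L and is expanded around 27/50, which makes every
      term visibly nonnegative. The target for q is 1.8546 - 17/20 = 5023/5000, less the 3/20 * r
      that large summands cost in the total.\<close>
    have "(5023 / 5000 - 3 / 20 * r) * E - (1 - r * L)
        = 0.0046 + 0.309632 * r + 0.012 * (r * r) + r * (1.0092 - 0.3 * r) * (0.54 - L)"
      by (simp add: E_def field_simps)
    also have "\<dots> \<ge> 0" using r L by simp
    finally have *: "1 - r * L \<le> (5023 / 5000 - 3 / 20 * r) * E" by simp
    define q where "q = (1 - r * L) / E"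
    from * have key: "q \<le> 5023 / 5000 - 3 / 20 * r"
      using E by (simp add: q_def divide_le_eq)
    have "\<bar>m.prob {..<x} - \<Phi> x\<bar> \<le> 17 / 20 * \<beta>3 + L / (2 * (E / 2)) * (1 - \<beta>2) + \<beta>2"
      by (rule normal_approximation_truncated[OF L0 _ E_eq]) (use E in simp)
    also have "\<dots> = L * (17 / 20 * (1 - r) + q + r)"
      by (simp add: q_def \<beta>2 \<beta>3 algebra_simps diff_divide_distrib)
    also have "\<dots> \<le> L * (9273 / 5000)"
    proof (rule mult_left_mono)
      show "17 / 20 * (1 - r) + q + r \<le> 9273 / 5000" using key by (simp add: field_simps)
    qed (use L0 in simp)
    finally show ?thesis by (simp add: mult.commute)
  qed
  then show ?thesis by (simp add: L_def \<beta>2_plus_\<beta>3)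
qed

end

section \<open>Poisson random sums\<close>

lemma integrable_shift_pair:
  fixes f :: "real \<Rightarrow> real"
  assumes "real_distribution \<nu>" "real_distribution \<mu>" "integrable \<mu> (\<lambda>y. y)"
    and f[measurable]: "f \<in> borel_measurable borel" and B: "\<And>w. \<bar>f w\<bar> \<le> B"
  shows "integrable (\<nu> \<Otimes>\<^sub>M \<mu>) (\<lambda>(w, y). y * f (w + y))"
proof -
  interpret \<nu>: real_distribution \<nu> by fact
  interpret \<mu>: real_distribution \<mu> by fact
  interpret pair_sigma_finite \<nu> \<mu> ..
  have le: "\<bar>y * f (w + y)\<bar> \<le> B * \<bar>y\<bar>" for w y
    using mult_right_mono[OF B[of "w + y"], of "\<bar>y\<bar>"] by (simp add: abs_mult mult.commute)
  have int: "integrable \<mu> (\<lambda>y. B * \<bar>y\<bar>)" using assms(3) by simp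
  have i: "integrable \<mu> (\<lambda>y. y * f (w + y))" for w
    by (rule Bochner_Integration.integrable_bound[OF int])
      (use order_trans[OF le abs_ge_self] in \<open>auto\<close>)
  show ?thesis
  proof (rule Fubini_integrable)
    have [measurable]: "(\<lambda>(w, y). y * f (w + y)) \<in> borel_measurable (borel \<Otimes>\<^sub>M borel)"
      by measurable
    show meas: "(\<lambda>(w, y). y * f (w + y)) \<in> borel_measurable (\<nu> \<Otimes>\<^sub>M \<mu>)"
      by (simp cong: measurable_cong_sets sets_pair_measure_cong)
    show "integrable \<nu> (\<lambda>w. \<integral>y. norm (case (w, y) of (w, y) \<Rightarrow> y * f (w + y)) \<partial>\<mu>)"
    proof (rule \<nu>.integrable_const_bound[where B = "\<integral>y. B * \<bar>y\<bar> \<partial>\<mu>"])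
      have n: "(\<integral>y. \<bar>y * f (w + y)\<bar> \<partial>\<mu>) \<le> (\<integral>y. B * \<bar>y\<bar> \<partial>\<mu>)" for w
        by (intro integral_mono integrable_abs i int le)
      have "\<bar>\<integral>y. \<bar>y * f (w + y)\<bar> \<partial>\<mu>\<bar> = (\<integral>y. \<bar>y * f (w + y)\<bar> \<partial>\<mu>)" for w
        by simp
      then show "AE w in \<nu>. norm (\<integral>y. norm (case (w, y) of (w, y) \<Rightarrow> y * f (w + y)) \<partial>\<mu>) \<le> (\<integral>y. B * \<bar>y\<bar> \<partial>\<mu>)"
        by (intro AE_I2) (simp only: prod.case real_norm_def n)
      show "(\<lambda>w. \<integral>y. norm (case (w, y) of (w, y) \<Rightarrow> y * f (w + y)) \<partial>\<mu>) \<in> borel_measurable \<nu>"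
        by measurable
    qed
    show "AE w in \<nu>. integrable \<mu> (\<lambda>y. case (w, y) of (w, y) \<Rightarrow> y * f (w + y))"
      using i by simp
  qed
qed

lemma integral_shift_swap:
  fixes f :: "real \<Rightarrow> real"
  assumes "real_distribution \<nu>" "real_distribution \<mu>" "integrable \<mu> (\<lambda>y. y)"
    and f[measurable]: "f \<in> borel_measurable borel" and B: "\<And>w. \<bar>f w\<bar> \<le> B"
  shows "(\<integral>y. y * (\<integral>w. f (w + y) \<partial>\<nu>) \<partial>\<mu>) = (\<integral>w. (\<integral>y. y * f (w + y) \<partial>\<mu>) \<partial>\<nu>)"
proof -
  interpret \<nu>: real_distribution \<nu> by fact
  interpret \<mu>: real_distribution \<mu> by fact
  interpret pair_sigma_finite \<nu> \<mu> ..
  show ?thesis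
    using Fubini_integral[OF integrable_shift_pair[OF assms]] by simp
qed

context prob_space
begin

text \<open>Fubini for the joint law, which independence makes a product: V is frozen first and
  integrated out afterwards.\<close>

lemma expectation_indep_pair:
  fixes H :: "real \<Rightarrow> real \<Rightarrow> real"
  assumes ind: "indep_var borel V borel U"
    and H[measurable]: "(\<lambda>(u, v). H u v) \<in> borel_measurable (borel \<Otimes>\<^sub>M borel)"
    and int: "integrable M (\<lambda>\<omega>. H (U \<omega>) (V \<omega>))"
  shows "expectation (\<lambda>\<omega>. H (U \<omega>) (V \<omega>)) = (\<integral>v. expectation (\<lambda>\<omega>. H (U \<omega>) v) \<partial>distr M borel V)"
proof -
  have [measurable]: "U \<in> borel_measurable M" "V \<in> borel_measurable M"
    and eq: "distr M borel V \<Otimes>\<^sub>M distr M borel U = distr M (borel \<Otimes>\<^sub>M borel) (\<lambda>\<omega>. (V \<omega>, U \<omega>))"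
    using ind unfolding indep_var_distribution_eq by auto
  interpret U: real_distribution "distr M borel U" by simp
  interpret V: real_distribution "distr M borel V" by simp
  interpret pair_sigma_finite "distr M borel V" "distr M borel U" ..
  have H'[measurable]: "(\<lambda>(v, u). H u v) \<in> borel_measurable (borel \<Otimes>\<^sub>M borel)"
    by measurable
  have i: "integrable (distr M borel V \<Otimes>\<^sub>M distr M borel U) (\<lambda>(v, u). H u v)"
    unfolding eq by (subst integrable_distr_eq) (use int in auto)
  have in_eq: "(\<integral>u. H u v \<partial>distr M borel U) = expectation (\<lambda>\<omega>. H (U \<omega>) v)" for v
    by (subst integral_distr) auto
  show "expectation (\<lambda>\<omega>. H (U \<omega>) (V \<omega>)) = (\<integral>v. expectation (\<lambda>\<omega>. H (U \<omega>) v) \<partial>distr M borel V)"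
    using integral_fst[OF i] unfolding in_eq eq by (subst (asm) integral_distr) auto
qed

end

section \<open>Partial sums of i.i.d. summands\<close>

locale iid_summands = prob_space M for M :: "'a measure" +
  fixes Y :: "nat \<Rightarrow> 'a \<Rightarrow> real"
  assumes Y_indep: "indep_vars (\<lambda>_. borel) Y UNIV"
    and Y_ident: "\<And>i. distr M borel (Y i) = distr M borel (Y 0)"
    and Y_int: "integrable M (Y 0)"
begin

abbreviation \<mu> :: "real measure" where "\<mu> \<equiv> distr M borel (Y 0)"

definition S :: "nat \<Rightarrow> 'a \<Rightarrow> real" where "S n \<omega> = (\<Sum>i<n. Y i \<omega>)"

lemma Y_measurable [measurable]: "Y i \<in> borel_measurable M"
  using Y_indep unfolding indep_vars_def by blast

lemma S_measurable [measurable]: "S n \<in> borel_measurable M"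
  unfolding S_def by measurable

lemma integrable_\<mu>: "integrable \<mu> (\<lambda>y. y)"
  using Y_int by (subst integrable_distr_eq) auto

lemma integrable_Y: "integrable M (Y i)"
proof -
  have "integrable (distr M borel (Y i)) (\<lambda>y. y)"
    by (subst Y_ident) (rule integrable_\<mu>)
  then show ?thesis by (subst (asm) integrable_distr_eq) auto
qed

lemma expectation_abs_Y: "expectation (\<lambda>\<omega>. \<bar>Y i \<omega>\<bar>) = expectation (\<lambda>\<omega>. \<bar>Y 0 \<omega>\<bar>)"
proof -
  have "expectation (\<lambda>\<omega>. \<bar>Y j \<omega>\<bar>) = (\<integral>y. \<bar>y\<bar> \<partial>distr M borel (Y j))" for j
    by (subst integral_distr) auto
  then show ?thesis by (metis Y_ident)
qed

lemma S_0: "S 0 = (\<lambda>_. 0)"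
  by (simp add: S_def fun_eq_iff)

lemma S_Suc: "S (Suc n) = (\<lambda>\<omega>. S n \<omega> + Y n \<omega>)"
  by (simp add: S_def fun_eq_iff)

lemma integrable_S: "integrable M (S n)"
  unfolding S_def using integrable_Y by simp

lemma expectation_abs_S: "expectation (\<lambda>\<omega>. \<bar>S n \<omega>\<bar>) \<le> n * expectation (\<lambda>\<omega>. \<bar>Y 0 \<omega>\<bar>)"
proof -
  have "expectation (\<lambda>\<omega>. \<bar>S n \<omega>\<bar>) \<le> expectation (\<lambda>\<omega>. \<Sum>i<n. \<bar>Y i \<omega>\<bar>)"
    using integrable_S integrable_Y
    by (intro integral_mono) (auto simp: S_def)
  also have "\<dots> = (\<Sum>i<n. expectation (\<lambda>\<omega>. \<bar>Y i \<omega>\<bar>))"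
    using integrable_Y by simp
  also have "\<dots> = (\<Sum>i<n. expectation (\<lambda>\<omega>. \<bar>Y 0 \<omega>\<bar>))"
    by (intro sum.cong refl expectation_abs_Y)
  finally show ?thesis by simp
qed

lemma indep_Y_S: "indep_var borel (Y n) borel (S n)"
  unfolding S_def[abs_def]
  by (intro indep_vars_sum indep_vars_subset[OF Y_indep]) auto

lemma mult_bounded_integrable:
  fixes U Z :: "'a \<Rightarrow> real"
  assumes "integrable M U" "Z \<in> borel_measurable M" "\<And>\<omega>. \<bar>Z \<omega>\<bar> \<le> B"
  shows "integrable M (\<lambda>\<omega>. U \<omega> * Z \<omega>)"
proof (rule Bochner_Integration.integrable_bound)
  show "integrable M (\<lambda>\<omega>. U \<omega> * B)" using assms(1) by simp
  have "\<bar>U \<omega>\<bar> * \<bar>Z \<omega>\<bar> \<le> \<bar>U \<omega>\<bar> * \<bar>B\<bar>" for \<omega>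
    using assms(3)[of \<omega>] by (intro mult_left_mono) auto
  then show "AE \<omega> in M. norm (U \<omega> * Z \<omega>) \<le> norm (U \<omega> * B)"
    by (simp add: abs_mult)
qed (use assms in simp)

lemma bounded_integrable:
  fixes Z :: "'a \<Rightarrow> real"
  assumes "Z \<in> borel_measurable M" "\<And>\<omega>. \<bar>Z \<omega>\<bar> \<le> B"
  shows "integrable M Z"
  by (rule integrable_const_bound[where B = B]) (use assms in auto)

text \<open>Exchangeability of the summands in disguise: the left-hand side is a sum of \<open>Suc n\<close>
  equal terms \<open>expectation (\<lambda>\<omega>. Y i \<omega> * f (S (Suc n) \<omega>))\<close>.\<close>

lemma expectation_S_mult:
  assumes f[measurable]: "f \<in> borel_measurable borel" and B: "\<And>w. \<bar>f w\<bar> \<le> B"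
  shows "expectation (\<lambda>\<omega>. S (Suc n) \<omega> * f (S (Suc n) \<omega>))
    = Suc n * (\<integral>y. y * expectation (\<lambda>\<omega>. f (S n \<omega> + y)) \<partial>\<mu>)"
  using f B
proof (induction n arbitrary: f)
  case 0
  note [measurable] = 0(1)
  show ?case by (simp add: S_0 S_Suc prob_space integral_distr)
next
  case (Suc n)
  note [measurable] = Suc.prems(1) and B = Suc.prems(2)
  let ?S = "S (Suc n)" and ?Y = "Y (Suc n)"
  have iY: "integrable M (\<lambda>\<omega>. ?Y \<omega> * f (?S \<omega> + ?Y \<omega>))"
    by (rule mult_bounded_integrable[OF integrable_Y]) (use B in auto)
  have iS: "integrable M (\<lambda>\<omega>. ?S \<omega> * f (?S \<omega> + ?Y \<omega>))"
    by (rule mult_bounded_integrable[OF integrable_S]) (use B in auto)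
  have 1: "expectation (\<lambda>\<omega>. ?Y \<omega> * f (?S \<omega> + ?Y \<omega>)) = (\<integral>y. y * expectation (\<lambda>\<omega>. f (?S \<omega> + y)) \<partial>\<mu>)"
    using expectation_indep_pair[OF indep_Y_S[of "Suc n"], of "\<lambda>u v. v * f (u + v)"] iY
    by (simp add: Y_ident[of "Suc n"])
  \<comment> \<open>Smoothing f by the first n summands reduces the step to two further summands,
    both with law \<open>\<mu>\<close>.\<close>
  define A where "A = (\<lambda>y. expectation (\<lambda>\<omega>. f (S n \<omega> + y)))"
  have A_meas[measurable]: "A \<in> borel_measurable borel" unfolding A_def by measurable
  have A_bound: "\<bar>A y\<bar> \<le> B" for y
  proof -
    have "\<bar>A y\<bar> \<le> expectation (\<lambda>\<omega>. \<bar>f (S n \<omega> + y)\<bar>)"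
      unfolding A_def by (rule integral_abs_bound)
    also have "\<dots> \<le> expectation (\<lambda>\<omega>. B)"
      by (intro integral_mono) (use B in \<open>auto intro!: bounded_integrable[where B = B]\<close>)
    finally show ?thesis by (simp add: prob_space)
  qed
  have Ef: "expectation (\<lambda>\<omega>. f (?S \<omega> + y)) = (\<integral>z. A (z + y) \<partial>\<mu>)" for y
    using expectation_indep_pair[OF indep_Y_S[of n], of "\<lambda>u v. f (u + v + y)"] B
    by (simp add: S_Suc Y_ident[of n] bounded_integrable[where B = B] A_def add.assoc)
  have Ag: "expectation (\<lambda>\<omega>. f (S n \<omega> + z + y)) = A (y + z)" for y z
    by (simp add: A_def add.assoc add.commute[of z y])
  \<comment> \<open>The last summand is frozen at y and the hypothesis is applied to the shifted
    function w -> f (w + y); hence the induction over arbitrary f.\<close>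
  have IH: "expectation (\<lambda>\<omega>. ?S \<omega> * f (?S \<omega> + y)) = Suc n * (\<integral>z. z * A (y + z) \<partial>\<mu>)" for y
    using Suc.IH[of "\<lambda>w. f (w + y)"] B unfolding Ag by simp
  have "expectation (\<lambda>\<omega>. ?S \<omega> * f (?S \<omega> + ?Y \<omega>)) = (\<integral>y. expectation (\<lambda>\<omega>. ?S \<omega> * f (?S \<omega> + y)) \<partial>\<mu>)"
    using expectation_indep_pair[OF indep_Y_S[of "Suc n"], of "\<lambda>u v. u * f (u + v)"] iS
    by (simp add: Y_ident[of "Suc n"])
  also have "\<dots> = Suc n * (\<integral>y. (\<integral>z. z * A (y + z) \<partial>\<mu>) \<partial>\<mu>)"
    unfolding IH by (rule integral_mult_right_zero)
  \<comment> \<open>This interchange is where the symmetry enters: the distinguished summand z and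
    the last one y swap roles, and integrating y turns \<open>A\<close> into the smoothing by n + 1
    summands.\<close>
  also have "(\<integral>y. (\<integral>z. z * A (y + z) \<partial>\<mu>) \<partial>\<mu>) = (\<integral>z. z * (\<integral>y. A (y + z) \<partial>\<mu>) \<partial>\<mu>)"
    by (rule integral_shift_swap[symmetric, OF _ _ integrable_\<mu> A_meas A_bound]) auto
  also have "\<dots> = (\<integral>z. z * expectation (\<lambda>\<omega>. f (?S \<omega> + z)) \<partial>\<mu>)"
    unfolding Ef ..
  finally have 2: "expectation (\<lambda>\<omega>. ?S \<omega> * f (?S \<omega> + ?Y \<omega>)) = Suc n * \<dots>" .
  have "expectation (\<lambda>\<omega>. S (Suc (Suc n)) \<omega> * f (S (Suc (Suc n)) \<omega>)) =
      expectation (\<lambda>\<omega>. ?S \<omega> * f (?S \<omega> + ?Y \<omega>)) + expectation (\<lambda>\<omega>. ?Y \<omega> * f (?S \<omega> + ?Y \<omega>))"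
    using iS iY by (simp add: S_Suc[of "Suc n"] distrib_right)
  also have "\<dots> = Suc (Suc n) * (\<integral>y. y * expectation (\<lambda>\<omega>. f (?S \<omega> + y)) \<partial>\<mu>)"
    unfolding 1 2 of_nat_Suc[of "Suc n"] by (simp only: distrib_right mult_1_left add.commute)
  finally show ?case .
qed

end

section \<open>Mixing over the Poisson number of summands\<close>

locale poisson_sum = iid_summands M Y for M :: "'a measure" and Y :: "nat \<Rightarrow> 'a \<Rightarrow> real" +
  fixes N :: "'a \<Rightarrow> nat" and l :: real
  assumes l_pos: "l > 0"
    and N_meas [measurable]: "N \<in> measurable M (count_space UNIV)"
    and N_poisson: "distr M (count_space UNIV) N = measure_pmf (poisson_pmf l)"
    and N_indep: "\<And>n. indep_var borel (\<lambda>\<omega>. real (N \<omega>)) borel (S n)"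
begin

definition p :: "nat \<Rightarrow> real" where "p n = l ^ n / fact n * exp (- l)"

lemma p_nonneg: "0 \<le> p n"
  using l_pos by (simp add: p_def)

text \<open>The recursion special to Poisson weights: it absorbs the factor \<open>Suc n\<close>
  from exchangeability and lowers the index by one.\<close>

lemma p_Suc: "p (Suc n) * Suc n = l * p n"
  unfolding p_def fact_Suc by (simp del: of_nat_Suc add: field_simps)

lemma summable_p: "summable p"
  unfolding p_def using summable_exp[of l]
  by (intro summable_mult2) (simp add: divide_inverse mult.commute)

lemma summable_p_times: "summable (\<lambda>n. p n * n)"
proof -
  have "summable (\<lambda>n. p (Suc n) * Suc n)"
    unfolding p_Suc by (rule summable_mult[OF summable_p])
  then show ?thesis by (subst summable_Suc_iff[symmetric])
qed

lemma expectation_indicator_N: "expectation (\<lambda>\<omega>. indicator {real n} (real (N \<omega>))) = p n"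
proof -
  have "expectation (\<lambda>\<omega>. indicator {real n} (real (N \<omega>))) = expectation (\<lambda>\<omega>. indicat_real {n} (N \<omega>))"
    by (intro Bochner_Integration.integral_cong) (auto simp: indicator_def)
  also have "\<dots> = (\<integral>k. indicat_real {n} k \<partial>distr M (count_space UNIV) N)"
    by (subst integral_distr) auto
  also have "\<dots> = p n"
    unfolding N_poisson using l_pos by (simp add: p_def measure_pmf_single)
  finally show ?thesis .
qed

definition W :: "'a \<Rightarrow> real" where "W \<omega> = S (N \<omega>) \<omega>"

lemma W_measurable [measurable]: "W \<in> borel_measurable M"
  unfolding W_def[abs_def] by (rule measurable_compose_countable[of _ _ _ N]) measurable

lemma
  assumes h[measurable]: "h \<in> borel_measurable borel"
    and B: "\<And>s. \<bar>h s\<bar> \<le> B * (1 + \<bar>s\<bar>)"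
  shows integrable_W: "integrable M (\<lambda>\<omega>. h (W \<omega>))"
    and expectation_W: "(\<lambda>n. p n * expectation (\<lambda>\<omega>. h (S n \<omega>))) sums expectation (\<lambda>\<omega>. h (W \<omega>))"
proof -
  define a where "a = expectation (\<lambda>\<omega>. \<bar>Y 0 \<omega>\<bar>)"
  \<comment> \<open>For each outcome only the term n = N is nonzero, so the series in n is h(W); the
    rest of the proof makes it absolutely summable in mean.\<close>
  define F where "F n \<omega> = indicator {real n} (real (N \<omega>)) * h (S n \<omega>)" for n \<omega>
  have B0: "0 \<le> B" using B[of 0] by simp
  have int_bound: "integrable M (\<lambda>\<omega>. B * (1 + \<bar>S n \<omega>\<bar>))" for n
    using integrable_S by simp
  have int_h: "integrable M (\<lambda>\<omega>. h (S n \<omega>))" for n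
    by (rule Bochner_Integration.integrable_bound[OF int_bound])
      (use order_trans[OF B abs_ge_self] in auto)
  have ind_meas: "(\<lambda>\<omega>. indicat_real {real n} (real (N \<omega>))) \<in> borel_measurable M" for n
    by measurable
  have int_ind: "integrable M (\<lambda>\<omega>. indicat_real {real n} (real (N \<omega>)))" for n
    by (rule bounded_integrable[OF ind_meas, where B = 1]) (auto simp: indicator_def)
  have E_prod: "expectation (\<lambda>\<omega>. indicator {real n} (real (N \<omega>)) * g (S n \<omega>)) = p n * expectation (\<lambda>\<omega>. g (S n \<omega>))"
    "integrable M (\<lambda>\<omega>. indicator {real n} (real (N \<omega>)) * g (S n \<omega>))"
    if g[measurable]: "g \<in> borel_measurable borel" and int: "integrable M (\<lambda>\<omega>. g (S n \<omega>))" for n and g :: "real \<Rightarrow> real"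
  proof -
    have ind: "indep_var borel (\<lambda>\<omega>. indicat_real {real n} (real (N \<omega>))) borel (\<lambda>\<omega>. g (S n \<omega>))"
      using indep_var_compose[OF N_indep[of n], of "indicat_real {real n}" borel g borel]
      by (simp add: comp_def)
    show "expectation (\<lambda>\<omega>. indicator {real n} (real (N \<omega>)) * g (S n \<omega>)) = p n * expectation (\<lambda>\<omega>. g (S n \<omega>))"
      using indep_var_lebesgue_integral[OF ind int_ind int] by (simp add: expectation_indicator_N)
    show "integrable M (\<lambda>\<omega>. indicator {real n} (real (N \<omega>)) * g (S n \<omega>))"
      by (rule indep_var_integrable[OF ind int_ind int])
  qed
  have int_F: "integrable M (F n)" for n
    unfolding F_def by (rule E_prod(2)[OF h int_h])
  have F_sums: "(\<lambda>n. F n \<omega>) sums h (W \<omega>)" "summable (\<lambda>n. norm (F n \<omega>))" for \<omega>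
  proof -
    have F_eq: "F n \<omega> = (if n = N \<omega> then h (S n \<omega>) else 0)" for n
      by (simp add: F_def indicator_def)
    show "(\<lambda>n. F n \<omega>) sums h (W \<omega>)"
      unfolding F_eq W_def by (rule sums_single)
    have "(\<lambda>n. norm (F n \<omega>)) = (\<lambda>n. if n = N \<omega> then \<bar>h (S n \<omega>)\<bar> else 0)"
      by (auto simp: F_eq)
    then show "summable (\<lambda>n. norm (F n \<omega>))"
      using sums_single[of "N \<omega>" "\<lambda>n. \<bar>h (S n \<omega>)\<bar>"] by (simp add: sums_iff)
  qed
  have norm_F: "expectation (\<lambda>\<omega>. norm (F n \<omega>)) \<le> B * p n + B * a * (p n * n)" for n
  proof -
    have "expectation (\<lambda>\<omega>. \<bar>h (S n \<omega>)\<bar>) \<le> expectation (\<lambda>\<omega>. B * (1 + \<bar>S n \<omega>\<bar>))"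
      by (intro integral_mono integrable_abs int_h int_bound B)
    also have "\<dots> = B * (1 + expectation (\<lambda>\<omega>. \<bar>S n \<omega>\<bar>))"
      using integrable_S by (simp add: prob_space)
    also have "\<dots> \<le> B * (1 + n * a)"
      unfolding a_def using B0 by (intro mult_left_mono add_left_mono expectation_abs_S)
    finally have "p n * expectation (\<lambda>\<omega>. \<bar>h (S n \<omega>)\<bar>) \<le> p n * (B * (1 + n * a))"
      using p_nonneg by (rule mult_left_mono)
    moreover have "expectation (\<lambda>\<omega>. norm (F n \<omega>)) = p n * expectation (\<lambda>\<omega>. \<bar>h (S n \<omega>)\<bar>)"
      using E_prod(1)[of "\<lambda>s. \<bar>h s\<bar>" n] int_h by (simp add: F_def abs_mult)
    ultimately show ?thesis by (simp add: algebra_simps)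
  qed
  have "summable (\<lambda>n. B * p n + B * a * (p n * n))"
    by (intro summable_add summable_mult summable_p summable_p_times)
  then have sum_norm: "summable (\<lambda>n. expectation (\<lambda>\<omega>. norm (F n \<omega>)))"
    by (rule summable_comparison_test') (use norm_F in simp)
  have AE_F: "AE \<omega> in M. summable (\<lambda>n. norm (F n \<omega>))" using F_sums(2) by simp
  have W_eq: "(\<lambda>\<omega>. \<Sum>n. F n \<omega>) = (\<lambda>\<omega>. h (W \<omega>))"
    using F_sums(1) by (auto simp: sums_iff)
  show "integrable M (\<lambda>\<omega>. h (W \<omega>))"
    using integrable_suminf[OF int_F AE_F sum_norm] unfolding W_eq .
  have "expectation (F n) = p n * expectation (\<lambda>\<omega>. h (S n \<omega>))" for n
    unfolding F_def by (rule E_prod(1)[OF h int_h])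
  then show "(\<lambda>n. p n * expectation (\<lambda>\<omega>. h (S n \<omega>))) sums expectation (\<lambda>\<omega>. h (W \<omega>))"
    using sums_integral[OF int_F AE_F sum_norm] unfolding W_eq by simp
qed

text \<open>Expanding over N, the identity for n + 1 summands with weight \<open>p (Suc n)\<close>
  becomes l times the n-th term of E G(W), and G is the inner integral after Fubini.\<close>

lemma expectation_W_mult:
  assumes f[measurable]: "f \<in> borel_measurable borel" and B: "\<And>w. \<bar>f w\<bar> \<le> B"
  shows "expectation (\<lambda>\<omega>. W \<omega> * f (W \<omega>)) = l * (\<integral>y. y * expectation (\<lambda>\<omega>. f (W \<omega> + y)) \<partial>\<mu>)"
proof -
  have B0: "0 \<le> B" using B[of 0] by simp
  define G where "G s = (\<integral>y. y * f (s + y) \<partial>\<mu>)" for s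
  interpret \<mu>: real_distribution \<mu> by simp
  have G_meas[measurable]: "G \<in> borel_measurable borel" unfolding G_def by measurable
  define C where "C = (\<integral>y. \<bar>y\<bar> * B \<partial>\<mu>)"
  have C0: "0 \<le> C" unfolding C_def using B0 by (simp add: Bochner_Integration.integral_nonneg)
  have G_bound: "\<bar>G s\<bar> \<le> C * (1 + \<bar>s\<bar>)" for s
  proof -
    have le: "\<bar>y * f (s + y)\<bar> \<le> \<bar>y\<bar> * B" for y
      unfolding abs_mult by (intro mult_left_mono B) simp
    have int: "integrable \<mu> (\<lambda>y. \<bar>y\<bar> * B)" using integrable_\<mu> by simp
    have "integrable \<mu> (\<lambda>y. y * f (s + y))"
      by (rule Bochner_Integration.integrable_bound[OF int])
        (use order_trans[OF le abs_ge_self] in auto)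
    then have "(\<integral>y. \<bar>y * f (s + y)\<bar> \<partial>\<mu>) \<le> C"
      unfolding C_def using int le by (intro integral_mono integrable_abs)
    then have "\<bar>G s\<bar> \<le> C"
      unfolding G_def by (rule order_trans[OF integral_abs_bound])
    also have "C \<le> C * (1 + \<bar>s\<bar>)" using C0 by (simp add: algebra_simps)
    finally show ?thesis .
  qed
  have swap: "(\<integral>y. y * expectation (\<lambda>\<omega>. f (U \<omega> + y)) \<partial>\<mu>) = expectation (\<lambda>\<omega>. G (U \<omega>))"
    if [measurable]: "U \<in> borel_measurable M" for U :: "'a \<Rightarrow> real"
  proof -
    have e: "expectation (\<lambda>\<omega>. f (U \<omega> + y)) = (\<integral>w. f (w + y) \<partial>distr M borel U)" for y
      by (subst integral_distr) auto
    have "(\<integral>y. y * (\<integral>w. f (w + y) \<partial>distr M borel U) \<partial>\<mu>) = (\<integral>w. G w \<partial>distr M borel U)"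
      unfolding G_def by (rule integral_shift_swap[OF _ _ integrable_\<mu> f B]) auto
    also have "\<dots> = expectation (\<lambda>\<omega>. G (U \<omega>))"
      by (subst integral_distr) auto
    finally show ?thesis unfolding e .
  qed
  have "\<bar>s * f s\<bar> \<le> B * (1 + \<bar>s\<bar>)" for s
    using mult_mono[OF B[of s], of "\<bar>s\<bar>" "1 + \<bar>s\<bar>"] B0 by (simp add: abs_mult mult.commute)
  then have "(\<lambda>n. p n * expectation (\<lambda>\<omega>. S n \<omega> * f (S n \<omega>))) sums expectation (\<lambda>\<omega>. W \<omega> * f (W \<omega>))"
    using expectation_W[of "\<lambda>s. s * f s" B] by simp
  \<comment> \<open>Dropping the term n = 0 is free because the empty sum is 0.\<close>
  then have "(\<lambda>n. p (Suc n) * expectation (\<lambda>\<omega>. S (Suc n) \<omega> * f (S (Suc n) \<omega>))) sums expectation (\<lambda>\<omega>. W \<omega> * f (W \<omega>))"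
    by (subst sums_Suc_iff) (simp add: S_0)
  moreover have "p (Suc n) * expectation (\<lambda>\<omega>. S (Suc n) \<omega> * f (S (Suc n) \<omega>))
      = l * (p n * expectation (\<lambda>\<omega>. G (S n \<omega>)))" for n
    unfolding expectation_S_mult[OF f B] swap[OF S_measurable]
    using p_Suc[of n] by (simp only: mult.assoc[symmetric])
  ultimately have "(\<lambda>n. l * (p n * expectation (\<lambda>\<omega>. G (S n \<omega>)))) sums expectation (\<lambda>\<omega>. W \<omega> * f (W \<omega>))"
    by simp
  moreover have "(\<lambda>n. l * (p n * expectation (\<lambda>\<omega>. G (S n \<omega>)))) sums (l * expectation (\<lambda>\<omega>. G (W \<omega>)))"
    by (rule sums_mult[OF expectation_W[OF G_meas G_bound]])
  ultimately have "expectation (\<lambda>\<omega>. W \<omega> * f (W \<omega>)) = l * expectation (\<lambda>\<omega>. G (W \<omega>))"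
    by (rule sums_unique2)
  then show ?thesis unfolding swap[OF W_measurable] .
qed

lemma compound_poisson_stein_W:
  assumes mean: "expectation (Y 0) = 0"
    and int2: "integrable M (\<lambda>\<omega>. (Y 0 \<omega>)\<^sup>2)" and var: "l * expectation (\<lambda>\<omega>. (Y 0 \<omega>)\<^sup>2) = 1"
  shows "compound_poisson_stein (distr M borel W) \<mu> l"
proof -
  interpret W: real_distribution "distr M borel W" by simp
  interpret \<mu>: real_distribution \<mu> by simp
  show ?thesis
  proof
    show "0 < l" by (rule l_pos)
    show "integrable (distr M borel W) (\<lambda>w. w)"
      using integrable_W[of "\<lambda>w. w" 1] by (subst integrable_distr_eq) auto
    show "integrable \<mu> (\<lambda>y. y)" by (rule integrable_\<mu>)
    show "integrable \<mu> (\<lambda>y. y\<^sup>2)" using int2 by (subst integrable_distr_eq) auto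
    show "(\<integral>y. y \<partial>\<mu>) = 0" using mean by (subst integral_distr) auto
    show "l * (\<integral>y. y\<^sup>2 \<partial>\<mu>) = 1" using var by (subst integral_distr) auto
    fix f :: "real \<Rightarrow> real" and B
    assume f[measurable]: "f \<in> borel_measurable borel" and B: "\<And>w. \<bar>f w\<bar> \<le> B"
    have e: "(\<integral>w. f (w + y) \<partial>distr M borel W) = expectation (\<lambda>\<omega>. f (W \<omega> + y))" for y
      by (subst integral_distr) auto
    have "(\<integral>w. w * f w \<partial>distr M borel W) = expectation (\<lambda>\<omega>. W \<omega> * f (W \<omega>))"
      by (subst integral_distr) auto
    then show "(\<integral>w. w * f w \<partial>distr M borel W) = l * (\<integral>y. y * (\<integral>w. f (w + y) \<partial>distr M borel W) \<partial>\<mu>)"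
      unfolding e expectation_W_mult[OF f B] .
  qed
qed

end

theorem theorem7:
  fixes M :: "'a measure" and X :: "nat \<Rightarrow> 'a \<Rightarrow> real" and N :: "'a \<Rightarrow> nat"
    and \<sigma> l :: real
  assumes "prob_space M"
    and meas: "\<And>i. X i \<in> borel_measurable M"
    and indep: "prob_space.indep_vars M (\<lambda>_. borel) X UNIV"
    and ident: "\<And>i. distr M borel (X i) = distr M borel (X 0)"
    and int1: "integrable M (X 0)"
    and mean0: "prob_space.expectation M (X 0) = 0"
    and int2: "integrable M (\<lambda>\<omega>. (X 0 \<omega>)\<^sup>2)"
    and sigma_pos: "\<sigma> > 0"
    and var: "prob_space.expectation M (\<lambda>\<omega>. (X 0 \<omega>)\<^sup>2) = \<sigma>\<^sup>2"
    and l_pos: "l > 0"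
    and N_meas: "N \<in> measurable M (count_space UNIV)"
    and N_poisson: "distr M (count_space UNIV) N = measure_pmf (poisson_pmf l)"
    and N_indep: "prob_space.indep_vars M (\<lambda>_. borel)
                    (\<lambda>j \<omega>. case j of None \<Rightarrow> real (N \<omega>) | Some i \<Rightarrow> X i \<omega>) UNIV"
  shows "\<forall>x::real. \<bar>prob_space.prob M {\<omega> \<in> space M. (\<Sum>i<N \<omega>. X i \<omega>) < x * \<sigma> * sqrt l}
                      - std_normal_cdf x\<bar>
           \<le> 1.8546 / \<sigma>\<^sup>2 * prob_space.expectation M
                (\<lambda>\<omega>. (X 0 \<omega>)\<^sup>2 * min 1 (\<bar>X 0 \<omega>\<bar> / (\<sigma> * sqrt l)))"
proof
  fix x :: real
  interpret prob_space M by fact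
  note [measurable] = meas
  \<comment> \<open>The standard deviation of the random sum; after division by it the truncation
    point in the bound is 1.\<close>
  define c where "c = \<sigma> * sqrt l"
  have c: "c > 0" "c\<^sup>2 = \<sigma>\<^sup>2 * l" using sigma_pos l_pos by (auto simp: c_def power_mult_distrib)
  define Y where "Y i \<omega> = X i \<omega> / c" for i \<omega>
  interpret iid_summands M Y
  proof
    show "indep_vars (\<lambda>_. borel) Y UNIV"
      unfolding Y_def[abs_def] by (rule indep_vars_compose2[OF indep]) auto
    show "integrable M (Y 0)" unfolding Y_def using int1 by simp
    have Y_eq: "distr M borel (Y i) = distr (distr M borel (X i)) borel (\<lambda>x. x / c)" for i
      by (subst distr_distr) (auto simp: Y_def[abs_def] comp_def)
    show "distr M borel (Y i) = distr M borel (Y 0)" for i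
      unfolding Y_eq by (subst ident) (rule refl)
  qed
  let ?N = "\<lambda>\<omega>. real (N \<omega>)"
  let ?Z = "\<lambda>j. case j of None \<Rightarrow> ?N | Some i \<Rightarrow> Y i"
  have Z_indep: "indep_vars (\<lambda>_. borel) ?Z UNIV"
  proof -
    have "indep_vars (\<lambda>_. borel) (\<lambda>j \<omega>. (case j of None \<Rightarrow> (\<lambda>r. r) | Some i \<Rightarrow> (\<lambda>r. r / c))
        (case j of None \<Rightarrow> real (N \<omega>) | Some i \<Rightarrow> X i \<omega>)) UNIV"
      by (rule indep_vars_compose2[OF N_indep]) (auto split: option.split)
    moreover have "(\<lambda>j \<omega>. (case j of None \<Rightarrow> (\<lambda>r. r) | Some i \<Rightarrow> (\<lambda>r. r / c))
        (case j of None \<Rightarrow> real (N \<omega>) | Some i \<Rightarrow> X i \<omega>)) = ?Z"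
      by (auto simp: fun_eq_iff Y_def split: option.split)
    ultimately show ?thesis by simp
  qed
  interpret poisson_sum M Y N l
  proof
    fix n
    have "indep_var borel (?Z None) borel (\<lambda>\<omega>. \<Sum>j\<in>Some ` {..<n}. ?Z j \<omega>)"
      by (intro indep_vars_sum indep_vars_subset[OF Z_indep]) auto
    moreover have "(\<lambda>\<omega>. \<Sum>j\<in>Some ` {..<n}. ?Z j \<omega>) = S n"
      by (simp add: fun_eq_iff S_def sum.reindex)
    ultimately show "indep_var borel ?N borel (S n)" by simp
  qed (use l_pos N_meas N_poisson in auto)
  interpret compound_poisson_stein "distr M borel W" \<mu> l
  proof (rule compound_poisson_stein_W)
    show "expectation (Y 0) = 0" unfolding Y_def using mean0 by simp
    show "integrable M (\<lambda>\<omega>. (Y 0 \<omega>)\<^sup>2)" unfolding Y_def power_divide using int2 by simp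
    show "l * expectation (\<lambda>\<omega>. (Y 0 \<omega>)\<^sup>2) = 1"
      unfolding Y_def power_divide c(2) using var sigma_pos l_pos by simp
  qed
  have W_less: "W \<omega> < x \<longleftrightarrow> (\<Sum>i<N \<omega>. X i \<omega>) < x * \<sigma> * sqrt l" for \<omega>
    using c(1) unfolding W_def S_def Y_def sum_divide_distrib[symmetric]
    by (simp add: divide_less_eq c_def mult.assoc)
  have lhs: "measure (distr M borel W) {..<x} = prob {\<omega> \<in> space M. (\<Sum>i<N \<omega>. X i \<omega>) < x * \<sigma> * sqrt l}"
    by (subst measure_distr) (auto simp: W_less intro!: arg_cong[where f = prob])
  have "l * (\<integral>y. y\<^sup>2 * min 1 \<bar>y\<bar> \<partial>\<mu>) = l * expectation (\<lambda>\<omega>. (Y 0 \<omega>)\<^sup>2 * min 1 \<bar>Y 0 \<omega>\<bar>)"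
    by (subst integral_distr) auto
  also have "expectation (\<lambda>\<omega>. (Y 0 \<omega>)\<^sup>2 * min 1 \<bar>Y 0 \<omega>\<bar>)
      = expectation (\<lambda>\<omega>. (X 0 \<omega>)\<^sup>2 * min 1 (\<bar>X 0 \<omega>\<bar> / c) / c\<^sup>2)"
    using c(1) by (simp add: Y_def power_divide)
  also have "l * \<dots> = 1 / \<sigma>\<^sup>2 * expectation (\<lambda>\<omega>. (X 0 \<omega>)\<^sup>2 * min 1 (\<bar>X 0 \<omega>\<bar> / c))"
    using l_pos sigma_pos by (simp add: c(2))
  finally have rhs: "l * (\<integral>y. y\<^sup>2 * min 1 \<bar>y\<bar> \<partial>\<mu>)
      = 1 / \<sigma>\<^sup>2 * expectation (\<lambda>\<omega>. (X 0 \<omega>)\<^sup>2 * min 1 (\<bar>X 0 \<omega>\<bar> / c))" .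
  show "\<bar>prob {\<omega> \<in> space M. (\<Sum>i<N \<omega>. X i \<omega>) < x * \<sigma> * sqrt l} - std_normal_cdf x\<bar>
      \<le> 1.8546 / \<sigma>\<^sup>2 * expectation (\<lambda>\<omega>. (X 0 \<omega>)\<^sup>2 * min 1 (\<bar>X 0 \<omega>\<bar> / (\<sigma> * sqrt l)))"
    using normal_approximation[of x] unfolding lhs rhs c_def times_divide_eq_left mult_1_left times_divide_eq_right .
qed

end
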